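(* Let $p\in(1,\infty]$, $n\ge 3$ and $x\in\mathbb{B}^n\setminus\{0\}$. Let $n_x=\frac{x}{|x|}$ and let $t_x$ be any unit vector in $\mathbb{R}^n$ such that $\langle t_x,x\rangle=0$. Then $$\max_{\ell\in\mathbb{S}^{n-1}}\mathcal{C}_p(x;\ell)=\begin{cases}\mathcal{C}_p(x;n_x) & \text{if } 1<p<n,\\ \mathcal{C}_p(x;t_x) & \text{if } p>n,\end{cases}$$ and $$\min_{\ell\in\mathbb{S}^{n-1}}\mathcal{C}_p(x;\ell)=\begin{cases}\mathcal{C}_p(x;t_x) & \text{if } 1<p<n,\\ \mathcal{C}_p(x;n_x) & \text{if } p>n.\end{cases}$$ If $p=n$ or $p=\infty$, then the map $\ell\mapsto\mathcal{C}_p(x;\ell)$ is constant on $\mathbb{S}^{n-1}$.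
   Context: $\mathbb{B}^n$ and $\mathbb{S}^{n-1}$ denote the open unit ball and the unit sphere of $\mathbb{R}^n$ with Euclidean norm $|\cdot|$ and inner product $\langle\cdot,\cdot\rangle$; $\sigma$ is the normalized (total mass $1$) surface measure on $\mathbb{S}^{n-1}$, and $\|\phi\|_p$ is the norm of $L^p(\mathbb{S}^{n-1},\mathbb{R})$ with respect to $\sigma$. For $\phi\in L^1(\mathbb{S}^{n-1},\mathbb{R})$ the invariant (hyperbolic) Poisson integral is $$\mathcal{P}_h[\phi](x)=\int_{\mathbb{S}^{n-1}}\mathcal{P}_h(x,\zeta)\phi(\zeta)\,d\sigma(\zeta),\qquad \mathcal{P}_h(x,\zeta)=\left(\frac{1-|x|^2}{|x-\zeta|^2}\right)^{n-1},\quad x\in\mathbb{B}^n.$$ For $p\in(1,\infty]$, $x\in\mathbb{B}^n\setminus\{0\}$ and $\ell\in\mathbb{S}^{n-1}$, $\mathcal{C}_p(x;\ell)$ denotes the optimal (smallest) number such that $$|\langle\nabla u(x),\ell\rangle|\le\mathcal{C}_p(x;\ell)\,\|\phi\|_p$$ for all $\phi\in L^p(\mathbb{S}^{n-1},\mathbb{R})$, where $u=\mathcal{P}_h[\phi]$ and $\nabla$ is the Euclidean gradient. *)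

theory Defs
  imports "HOL-Analysis.Analysis" "HOL-Probability.Essential_Supremum"
begin

text \<open>
  The normalized surface measure, obtained by polar coordinates: the mass of a Borel set
  \<open>A\<close> of the sphere is the proportion of the unit ball occupied by the cone
  \<open>{x. sgn x \<in> A}\<close> over it. The value \<open>sgn 0 = 0\<close> lies off the sphere but carries no mass, so
  restricting to the sphere keeps the total mass 1.
\<close>

definition sphere_measure :: "(real ^ 'n) measure" where
  "sphere_measure =
     restrict_space (distr (uniform_measure lborel (ball 0 1)) borel sgn) (sphere 0 1)"

lemma space_sphere_measure: "space sphere_measure = sphere 0 1"
  by (simp add: sphere_measure_def space_restrict_space)

lemma emeasure_sphere_measure_space:
  "emeasure (sphere_measure :: (real ^ 'n) measure) (sphere 0 1) = 1"
proof -
  let ?B = "ball (0 :: real ^ 'n) 1"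
  have sgn: "(sgn :: real ^ 'n \<Rightarrow> real ^ 'n) \<in> borel \<rightarrow>\<^sub>M borel"
    unfolding sgn_div_norm by measurable
  have fin: "emeasure lborel ?B \<noteq> \<infinity>"
    using emeasure_lborel_ball_finite[of "0 :: real ^ 'n" 1] by (simp add: less_top)
  have pos: "emeasure lborel ?B \<noteq> 0"
    using unit_ball_vol_pos[of "real CARD('n)"] by (simp add: emeasure_ball less_imp_neq[symmetric])
  have vim: "sgn -` sphere 0 1 = - {0 :: real ^ 'n}"
    by (auto simp: norm_sgn split: if_splits)
  have "emeasure (sphere_measure :: (real ^ 'n) measure) (sphere 0 1)
      = emeasure (uniform_measure lborel ?B) (- {0})"
    unfolding sphere_measure_def
    by (subst emeasure_restrict_space) (auto simp: emeasure_distr sgn vim)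
  also have "\<dots> = emeasure lborel (?B - {0}) / emeasure lborel ?B"
    by (simp add: Diff_eq)
  also have "emeasure lborel (?B - {0}) = emeasure lborel ?B"
    by (subst emeasure_Diff) auto
  finally show ?thesis
    using fin pos by (simp add: ennreal_divide_self less_top[symmetric])
qed

definition Lp_norm :: "ereal \<Rightarrow> 'a measure \<Rightarrow> ('a \<Rightarrow> real) \<Rightarrow> real" where
  "Lp_norm p M f =
     (if p = \<infinity> then real_of_ereal (esssup M (\<lambda>x. ereal \<bar>f x\<bar>))
      else (\<integral>x. \<bar>f x\<bar> powr real_of_ereal p \<partial>M) powr (1 / real_of_ereal p))"

definition Lp_space :: "ereal \<Rightarrow> 'a measure \<Rightarrow> ('a \<Rightarrow> real) set" where
  "Lp_space p M = {f \<in> borel_measurable M.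
     if p = \<infinity> then esssup M (\<lambda>x. ereal \<bar>f x\<bar>) < \<infinity>
     else integrable M (\<lambda>x. \<bar>f x\<bar> powr real_of_ereal p)}"

definition hyp_poisson_kernel :: "real ^ 'n \<Rightarrow> real ^ 'n \<Rightarrow> real" where
  "hyp_poisson_kernel x \<zeta> = ((1 - (norm x)\<^sup>2) / (norm (x - \<zeta>))\<^sup>2) ^ (CARD('n) - 1)"

definition hyp_poisson :: "(real ^ 'n \<Rightarrow> real) \<Rightarrow> real ^ 'n \<Rightarrow> real" where
  "hyp_poisson \<phi> x = (\<integral>\<zeta>. hyp_poisson_kernel x \<zeta> * \<phi> \<zeta> \<partial>sphere_measure)"

definition gradient :: "(real ^ 'n \<Rightarrow> real) \<Rightarrow> real ^ 'n \<Rightarrow> real ^ 'n" where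
  "gradient u x = (THE D. GDERIV u x :> D)"

text \<open>
  \<open>hyp_poisson \<phi>\<close> is differentiable in the unit ball for every \<open>\<phi>\<close> in \<open>L\<^sup>p\<close>, and the least constant
  exists (it is the norm of a bounded functional), so for \<open>norm x < 1\<close> neither \<open>THE\<close> nor \<open>LEAST\<close>
  takes an unspecified value.
\<close>

definition opt_const :: "ereal \<Rightarrow> real ^ 'n \<Rightarrow> real ^ 'n \<Rightarrow> real" where
  "opt_const p x l = (LEAST C. \<forall>\<phi> \<in> Lp_space p sphere_measure.
     \<bar>gradient (hyp_poisson \<phi>) x \<bullet> l\<bar> \<le> C * Lp_norm p sphere_measure \<phi>)"

definition is_max_on :: "('a \<Rightarrow> real) \<Rightarrow> 'a set \<Rightarrow> real \<Rightarrow> bool" where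
  "is_max_on f S m \<longleftrightarrow> m \<in> f ` S \<and> (\<forall>y \<in> f ` S. y \<le> m)"

definition is_min_on :: "('a \<Rightarrow> real) \<Rightarrow> 'a set \<Rightarrow> real \<Rightarrow> bool" where
  "is_min_on f S m \<longleftrightarrow> m \<in> f ` S \<and> (\<forall>y \<in> f ` S. m \<le> y)"

end

theory Submission
  imports Defs "HOL-Probability.Probability"
begin

text \<open>
  Write \<open>\<tau>\<close> for the map of the sphere that sends \<open>\<zeta>\<close> to the second point in which the line through
  \<open>\<zeta>\<close> and \<open>x\<close> meets the sphere (\<open>chord_map\<close>). It is an involution, and it is conformal with factor
  \<open>\<lambda>(\<zeta>) = (1 - |x|\<^sup>2) / |x - \<zeta>|\<^sup>2\<close> (\<open>chord_ratio\<close>), so its Jacobian on the sphere is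
  \<open>\<lambda>\<^sup>n\<^sup>-\<^sup>1\<close>, which is the hyperbolic Poisson kernel. Moreover the gradient of the kernel in \<open>x\<close> is
  \<open>-2 (n - 1) / (1 - |x|\<^sup>2)\<close> times the kernel times \<open>\<tau>(\<zeta>)\<close>: its direction is a unit vector.

  By duality, \<open>C\<^sub>p(x; l)\<close> is the \<open>L\<^sup>q\<close> norm of the derivative of the kernel in direction \<open>l\<close>, where
  \<open>1/p + 1/q = 1\<close> (\<open>opt_const_eq\<close>). Substituting \<open>\<eta> = \<tau>(\<zeta>)\<close> uses up one power of the kernel as
  Jacobian and inverts the others, so up to a factor independent of \<open>l\<close> the integral becomes
  \<open>\<integral> |x - \<eta>|\<^sup>2\<^sup>k |\<langle>\<eta>, l\<rangle>|\<^sup>q d\<sigma>(\<eta>)\<close> with \<open>k = (n - 1) (q - 1) = (n - 1) / (p - 1)\<close>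
  (\<open>integral_kernel_powr\<close>). Averaging over \<open>\<eta>\<close> and \<open>-\<eta>\<close> replaces the first factor by half a
  function \<open>F\<close> of \<open>|\<langle>\<eta>, n\<^sub>x\<rangle>|\<close>, namely \<open>F s = (a + b s)\<^sup>k + (a - b s)\<^sup>k\<close> with \<open>a = 1 + |x|\<^sup>2\<close> and
  \<open>b = 2 |x|\<close> (\<open>integral_symmetrize\<close>).

  On \<open>[0, 1]\<close> the function \<open>F\<close> increases if \<open>k \<ge> 1\<close>, that is \<open>p \<le> n\<close>, decreases if
  \<open>0 \<le> k \<le> 1\<close>, that is \<open>p \<ge> n\<close>, and is constant if \<open>k = 1\<close> or \<open>k = 0\<close>, that is \<open>p = n\<close> or
  \<open>p = \<infinity>\<close>. It remains to see that for increasing \<open>F\<close> and \<open>G\<close> the integral of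
  \<open>F |\<langle>\<eta>, n\<^sub>x\<rangle>| G |\<langle>\<eta>, l\<rangle>|\<close> is largest at \<open>l = n\<^sub>x\<close> and smallest at \<open>l \<bottom> n\<^sub>x\<close>
  (\<open>zonal_moment_le_pole\<close>, \<open>zonal_moment_ge_equator\<close>); for decreasing \<open>F\<close> this is applied to \<open>-F\<close>.
  Both comparisons come from one two-point rearrangement with respect to the reflection that
  exchanges the two directions.
\<close>

section \<open>The normalized surface measure\<close>

lemma sets_sphere_measure [measurable_cong]:
  "sets (sphere_measure :: (real ^ 'n) measure) = sets (restrict_space borel (sphere 0 1))"
  unfolding sphere_measure_def by (intro sets_restrict_space_cong) simp

lemma prob_space_sphere_measure: "prob_space (sphere_measure :: (real ^ 'n) measure)"
  by standard (simp add: space_sphere_measure emeasure_sphere_measure_space)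

lemma borel_measurable_sphere_measure:
  fixes f :: "real ^ 'n \<Rightarrow> 'b :: topological_space"
  assumes "f \<in> borel_measurable borel"
  shows "f \<in> borel_measurable sphere_measure"
  using measurable_restrict_space1[OF assms, of "sphere 0 1"]
  by (simp add: measurable_cong_sets[OF sets_sphere_measure refl])

lemma integrable_sphere_measure_bounded:
  fixes f :: "real ^ 'n \<Rightarrow> 'b :: {banach, second_countable_topology}"
  assumes "f \<in> borel_measurable borel" and "\<And>\<zeta>. norm \<zeta> = 1 \<Longrightarrow> norm (f \<zeta>) \<le> B"
  shows "integrable sphere_measure f"
proof -
  interpret prob_space "sphere_measure :: (real ^ 'n) measure"
    by (rule prob_space_sphere_measure)
  show ?thesis
    using assms(2) borel_measurable_sphere_measure[OF assms(1)]
    by (intro integrable_const_bound[where B = B] AE_I2) (auto simp: space_sphere_measure)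
qed

lemma integral_sphere_measure:
  fixes f :: "real ^ 'n \<Rightarrow> real"
  assumes [measurable]: "f \<in> borel_measurable borel"
  shows "(\<integral>\<zeta>. f \<zeta> \<partial>sphere_measure) =
    (\<integral>y. indicator (ball 0 1 - {0}) y * f (sgn y) \<partial>lborel) / measure lborel (ball (0 :: real ^ 'n) 1)"
proof -
  let ?B = "ball (0 :: real ^ 'n) 1"
  have [measurable]: "(sgn :: real ^ 'n \<Rightarrow> real ^ 'n) \<in> borel \<rightarrow>\<^sub>M borel"
    unfolding sgn_div_norm by measurable
  have [measurable]: "?B \<in> sets borel" "sphere (0 :: real ^ 'n) 1 \<in> sets borel"
    by (simp_all add: borel_closed)
  have fin: "emeasure lborel ?B < \<infinity>" by (rule emeasure_lborel_ball_finite)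
  have um: "uniform_measure lborel ?B = density lborel (\<lambda>y. ennreal (indicator ?B y / measure lborel ?B))"
    unfolding uniform_measure_def
  proof (intro density_cong AE_I2)
    show "(\<lambda>y. indicator ?B y / emeasure lborel ?B) \<in> borel_measurable lborel"
      unfolding divide_ennreal_def
      by (intro borel_measurable_times_ennreal borel_measurable_indicator borel_measurable_const) simp
    show "(\<lambda>y. ennreal (indicator ?B y / measure lborel ?B)) \<in> borel_measurable lborel"
      by (intro measurable_compose[OF _ measurable_ennreal] borel_measurable_divide
          borel_measurable_indicator borel_measurable_const) simp
  next
    fix y
    have "0 < measure lborel ?B" by simp
    then show "indicator ?B y / emeasure lborel ?B = ennreal (indicator ?B y / measure lborel ?B)"
      using fin by (auto simp: emeasure_eq_ennreal_measure divide_ennreal indicator_def simp flip: ennreal_1)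
  qed
  have sphere: "indicator (sphere 0 1) (sgn y) = (indicator (- {0}) y :: real)" for y :: "real ^ 'n"
    by (auto simp: norm_sgn indicator_def)
  have "(\<integral>\<zeta>. f \<zeta> \<partial>sphere_measure)
      = (\<integral>\<zeta>. indicator (sphere 0 1) \<zeta> *\<^sub>R f \<zeta> \<partial>distr (uniform_measure lborel ?B) borel sgn)"
    unfolding sphere_measure_def by (subst integral_restrict_space) auto
  also have "\<dots> = (\<integral>y. indicator (sphere 0 1) (sgn y) * f (sgn y) \<partial>uniform_measure lborel ?B)"
    by (subst integral_distr) auto
  also have "\<dots> = (\<integral>y. indicator ?B y / measure lborel ?B * (indicator (- {0}) y * f (sgn y)) \<partial>lborel)"
    unfolding um sphere by (subst integral_density) (auto)
  also have "\<dots> = (\<integral>y. indicator (?B - {0}) y * f (sgn y) / measure lborel ?B \<partial>lborel)"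
    by (intro Bochner_Integration.integral_cong refl) (auto simp: indicator_def)
  finally show ?thesis by simp
qed

section \<open>Determinant of a linear map that keeps radii and scales tangents\<close>

text \<open>
  A rotation that takes a coordinate axis to \<open>s\<close> makes the map diagonal, with entries \<open>1, c, \<dots>, c\<close>.
\<close>
lemma det_radial_stretch:
  fixes s :: "real ^ 'n"
  assumes "norm s = 1"
  shows "det (matrix (\<lambda>h. c *\<^sub>R h + ((1 - c) * (h \<bullet> s)) *\<^sub>R s)) = c ^ (CARD('n) - 1)"
proof -
  obtain k :: 'n where True by simp
  have "norm (axis k 1 :: real^'n) = norm s" using assms by simp
  then obtain R where R: "orthogonal_transformation R" "R (axis k 1 :: real^'n) = s"
    by (rule orthogonal_transformation_exists)
  have lin: "linear R" using R(1) by (rule orthogonal_transformation_linear)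
  let ?D = "\<lambda>h. c *\<^sub>R h + ((1 - c) * (h \<bullet> s)) *\<^sub>R s"
  let ?E = "\<lambda>h. c *\<^sub>R h + ((1 - c) * (h \<bullet> axis k 1)) *\<^sub>R (axis k 1 :: real^'n)"
  have linD: "linear ?D" by (intro linearI) (simp_all add: algebra_simps inner_add_left)
  have linE: "linear ?E" by (intro linearI) (simp_all add: algebra_simps inner_add_left)
  have "?D (R h) = R (?E h)" for h
  proof -
    have "R h \<bullet> s = h \<bullet> axis k 1"
      using R unfolding orthogonal_transformation_def by metis
    then show ?thesis
      by (simp only: linear_add[OF lin] linear_scale[OF lin] R(2))
  qed
  then have "?D \<circ> R = R \<circ> ?E" by (simp only: fun_eq_iff o_apply) simp
  then have "matrix ?D ** matrix R = matrix R ** matrix ?E"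
    using matrix_compose[OF lin linD] matrix_compose[OF linE lin] by argo
  then have "det (matrix ?D ** matrix R) = det (matrix R ** matrix ?E)"
    by (rule arg_cong)
  then have "det (matrix ?D) * det (matrix R) = det (matrix R) * det (matrix ?E)"
    by (simp only: det_mul)
  moreover have "det (matrix R) \<noteq> 0"
    using R(1) det_orthogonal_matrix[of "matrix R"]
    unfolding orthogonal_transformation_matrix by linarith
  ultimately have "det (matrix ?D) = det (matrix ?E)" by (simp only: mult.commute mult_cancel_left) simp
  also have "\<dots> = (\<Prod>i\<in>UNIV. matrix ?E $ i $ i)"
  proof (rule det_diagonal)
    fix i j :: 'n assume "i \<noteq> j"
    then show "matrix ?E $ i $ j = 0"
      by (auto simp: matrix_def inner_axis) (auto simp: axis_def)
  qed
  also have "\<dots> = (\<Prod>i\<in>UNIV. if i = k then 1 else c)"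
    by (rule prod.cong) (auto simp: matrix_def inner_axis, auto simp: axis_def)
  also have "\<dots> = c ^ (CARD('n) - 1)"
    by (subst prod.If_cases) (simp_all add: Collect_neg_eq[symmetric] card_Diff_singleton Compl_eq_Diff_UNIV)
  finally show ?thesis .
qed

text \<open>
  Undoing the tangential scaling first makes \<open>A\<close> norm preserving, hence orthogonal, so up to sign the
  determinant is that of the scaling. Asking for norms only, rather than for a factorization of \<open>A\<close>,
  makes the hypothesis easy to check for a derivative and invariant under isometries.
\<close>
lemma abs_det_radial_isometry:
  fixes A :: "real ^ 'n \<Rightarrow> real ^ 'n"
  assumes lin: "linear A" and s: "norm s = 1" and c: "c > 0"
    and norm_A: "\<And>h. (norm (A h))\<^sup>2 = (h \<bullet> s)\<^sup>2 + c\<^sup>2 * ((norm h)\<^sup>2 - (h \<bullet> s)\<^sup>2)"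
  shows "\<bar>det (matrix A)\<bar> = c ^ (CARD('n) - 1)"
proof -
  let ?D = "\<lambda>c h. c *\<^sub>R h + ((1 - c) * (h \<bullet> s)) *\<^sub>R s"
  have linD: "linear (?D c)" for c
    by (intro linearI) (auto simp: algebra_simps inner_add_left)
  have ss: "s \<bullet> s = 1" using s by (simp add: dot_square_norm)
  have inner_D: "?D (1/c) h \<bullet> s = h \<bullet> s" for h
    using c ss by (simp add: inner_add_left field_simps)
  have "(norm (A (?D (1/c) h)))\<^sup>2 = (norm h)\<^sup>2" for h
  proof -
    have "(norm (?D (1/c) h))\<^sup>2 = (1/c)\<^sup>2 * (h \<bullet> h) + (1 - (1/c)\<^sup>2) * (h \<bullet> s)\<^sup>2"
      unfolding power2_norm_eq_inner using ss
      by (simp add: inner_add_left inner_add_right inner_commute[of s h] algebra_simps power2_eq_square)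
    then show ?thesis
      unfolding norm_A inner_D using c
      by (simp add: power2_norm_eq_inner field_simps)
  qed
  then have "norm ((A \<circ> ?D (1/c)) h) = norm h" for h
    by (simp add: power2_eq_iff_nonneg)
  then have "orthogonal_transformation (A \<circ> ?D (1/c))"
    using linear_compose[OF linD lin] by (simp add: orthogonal_transformation)
  then have "\<bar>det (matrix (A \<circ> ?D (1/c)))\<bar> = 1"
    using det_orthogonal_matrix[of "matrix (A \<circ> ?D (1/c))"] by (auto simp: orthogonal_transformation_matrix)
  moreover have "det (matrix (A \<circ> ?D (1/c))) = det (matrix A) * (1/c) ^ (CARD('n) - 1)"
    using lin linD det_radial_stretch[OF s, of "1/c"] by (simp add: matrix_compose det_mul)
  ultimately have "\<bar>det (matrix A)\<bar> * (1/c) ^ (CARD('n) - 1) = 1"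
    using c by (simp only: abs_mult power_abs) simp
  then show ?thesis using c by (simp add: field_simps)
qed

section \<open>Well-ordered copies of finite index types\<close>

text \<open>
  The Jacobian change of variables below is for vectors indexed by a well-ordered finite type. This
  ordered copy of an arbitrary finite type, together with the isometry \<open>reindex\<close>, carries its
  consequences for the sphere over to any finite index type.
\<close>
typedef (overloaded) 'a index = "{..<CARD('a::finite)}"
  by (rule exI[of _ 0]) simp

instance index :: (finite) finite
proof
  show "finite (UNIV :: 'a index set)"
    using finite_imageD[of Rep_index "UNIV :: 'a index set"] type_definition.Rep_range[OF type_definition_index]
    by (metis Rep_index_inject finite_lessThan inj_onI)
qed

lemma card_index: "CARD('a::finite index) = CARD('a)"
  by (simp add: type_definition.card[OF type_definition_index])

instantiation index :: (finite) wellorder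
begin
definition less_eq_index :: "'a index \<Rightarrow> 'a index \<Rightarrow> bool" where
  "i \<le> j \<longleftrightarrow> Rep_index i \<le> Rep_index j"
definition less_index :: "'a index \<Rightarrow> 'a index \<Rightarrow> bool" where
  "i < j \<longleftrightarrow> Rep_index i < Rep_index j"
instance
proof
  fix P :: "'a index \<Rightarrow> bool" and a
  assume step: "\<And>x. (\<And>y. y < x \<Longrightarrow> P y) \<Longrightarrow> P x"
  show "P a"
    by (induction a rule: measure_induct_rule[of Rep_index]) (use step in \<open>auto simp: less_index_def\<close>)
qed (auto simp: less_eq_index_def less_index_def Rep_index_inject)
end

definition reindex :: "('m \<Rightarrow> 'n) \<Rightarrow> real ^ 'n \<Rightarrow> real ^ 'm" where
  "reindex b x = (\<chi> i. x $ b i)"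

lemma linear_reindex: "linear (reindex b)"
  by (intro linearI) (auto simp: reindex_def vec_eq_iff)

lemma measurable_reindex [measurable]: "reindex b \<in> borel \<rightarrow>\<^sub>M borel"
  by (intro borel_measurable_continuous_onI linear_continuous_on)
     (simp add: linear_reindex linear_conv_bounded_linear[symmetric])

lemma inner_reindex:
  assumes "bij b"
  shows "reindex b x \<bullet> reindex b y = x \<bullet> y"
  unfolding inner_vec_def reindex_def
  using sum.reindex_bij_betw[OF assms, of "\<lambda>i. x $ i * y $ i"] by simp

lemma norm_reindex:
  assumes "bij b"
  shows "norm (reindex b x) = norm x"
  using inner_reindex[OF assms, of x x] by (simp add: norm_eq_sqrt_inner)

lemma reindex_inv:
  assumes "bij b"
  shows "reindex (inv b) (reindex b x) = x" "reindex b (reindex (inv b) z) = z"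
  using assms by (simp_all add: reindex_def vec_eq_iff bij_is_surj surj_f_inv_f bij_is_inj inv_f_f)

text \<open>
  Permuting coordinates maps boxes to boxes with the same side lengths.
\<close>
lemma distr_reindex:
  fixes b :: "'m::finite \<Rightarrow> 'n::finite"
  assumes b: "bij b"
  shows "distr lborel borel (reindex b) = lborel"
proof (rule sym, rule lborel_eqI)
  fix l u :: "real ^ 'm"
  assume lu: "\<And>B. B \<in> Basis \<Longrightarrow> l \<bullet> B \<le> u \<bullet> B"
  then have le: "l $ i \<le> u $ i" for i
    using lu[of "axis i 1"] by (auto simp: Basis_vec_def inner_axis)
  let ?l = "reindex (inv b) l" and ?u = "reindex (inv b) u"
  have le': "?l $ i \<le> ?u $ i" for i using le by (simp add: reindex_def)
  have "reindex b -` box l u = box ?l ?u"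
    using b by (auto simp: mem_box_cart reindex_def) (metis bij_inv_eq_iff)+
  then have "emeasure (distr lborel borel (reindex b)) (box l u) = emeasure lborel (box ?l ?u)"
    by (simp add: emeasure_distr)
  also have "\<dots> = (\<Prod>B\<in>Basis. (?u - ?l) \<bullet> B)"
    using le' by (intro emeasure_lborel_box) (auto simp: Basis_vec_def inner_axis)
  also have "(\<Prod>B\<in>Basis. (?u - ?l) \<bullet> B) = (\<Prod>i\<in>UNIV. u $ inv b i - l $ inv b i)"
    by (simp add: Basis_vec_def UNION_singleton_eq_range prod.reindex inj_on_def axis_eq_axis inner_axis reindex_def)
  also have "\<dots> = (\<Prod>i\<in>UNIV. u $ i - l $ i)"
    using prod.reindex_bij_betw[OF bij_imp_bij_inv[OF b], of "\<lambda>i. u $ i - l $ i"] by simp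
  also have "\<dots> = (\<Prod>B\<in>Basis. (u - l) \<bullet> B)"
    by (simp add: Basis_vec_def UNION_singleton_eq_range prod.reindex inj_on_def axis_eq_axis inner_axis)
  finally show "emeasure (distr lborel borel (reindex b)) (box l u) = (\<Prod>B\<in>Basis. (u - l) \<bullet> B)" .
qed simp

lemma integral_sphere_measure_reindex:
  fixes b :: "'m::finite \<Rightarrow> 'n::finite" and f :: "real ^ 'm \<Rightarrow> real"
  assumes b: "bij b" and [measurable]: "f \<in> borel_measurable borel"
  shows "(\<integral>\<zeta>. f (reindex b \<zeta>) \<partial>sphere_measure) = (\<integral>\<zeta>. f \<zeta> \<partial>sphere_measure)"
proof -
  have [measurable]: "(sgn :: real ^ 'm \<Rightarrow> real ^ 'm) \<in> borel \<rightarrow>\<^sub>M borel"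
    unfolding sgn_div_norm by measurable
  have [measurable]: "ball (0 :: real ^ 'm) 1 - {0} \<in> sets borel" by simp
  have sgn: "reindex b (sgn y) = sgn (reindex b y)" for y
    by (simp add: sgn_div_norm norm_reindex[OF b] linear_scale[OF linear_reindex])
  have ind: "indicator (ball 0 1 - {0}) (reindex b y) = (indicator (ball 0 1 - {0}) y :: real)" for y
  proof -
    have "reindex b y = 0 \<longleftrightarrow> y = 0"
      using norm_reindex[OF b, of y] by (metis norm_eq_zero)
    then show ?thesis by (simp add: indicator_def norm_reindex[OF b])
  qed
  have vol: "measure lborel (ball (0 :: real ^ 'm) 1) = measure lborel (ball (0 :: real ^ 'n) 1)"
  proof -
    have "reindex b -` ball 0 1 = ball 0 1"
      using norm_reindex[OF b] by (auto simp: dist_norm)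
    then show ?thesis
      by (subst distr_reindex[OF b, symmetric]) (simp add: measure_distr)
  qed
  have "(\<integral>y. indicator (ball 0 1 - {0}) y * f (sgn y) \<partial>lborel)
      = (\<integral>y. indicator (ball 0 1 - {0}) (reindex b y) * f (sgn (reindex b y)) \<partial>lborel)"
    by (subst distr_reindex[OF b, symmetric], subst integral_distr) auto
  then show ?thesis
    by (simp add: integral_sphere_measure sgn ind vol)
qed

section \<open>Change of variables on the sphere\<close>

text \<open>
  Real-valued integrands are one-dimensional vectors.
\<close>
lemma has_absolute_integral_change_of_variables_scalar:
  fixes f :: "real ^ 'm::{finite,wellorder} \<Rightarrow> real" and g :: "real ^ 'm::_ \<Rightarrow> real ^ 'm::_"
  assumes "S \<in> sets lebesgue"
    and "\<And>x. x \<in> S \<Longrightarrow> (g has_derivative g' x) (at x within S)"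
    and "inj_on g S"
  shows "(\<lambda>x. \<bar>det (matrix (g' x))\<bar> * f (g x)) absolutely_integrable_on S \<and>
           integral S (\<lambda>x. \<bar>det (matrix (g' x))\<bar> * f (g x)) = b
     \<longleftrightarrow> f absolutely_integrable_on (g ` S) \<and> integral (g ` S) f = b"
  using has_absolute_integral_change_of_variables[OF assms, of "\<lambda>x. vec (f x) :: real ^ 1" "vec b"]
  unfolding absolutely_integrable_on_1_iff integral_on_1_eq by simp

text \<open>
  The surface measure is a cone measure, so a map of the sphere is best extended to a map \<open>g\<close> of the
  whole space that keeps norms and is homogeneous of degree 1. If it is conformal on the sphere with
  factor \<open>\<mu>\<close>, then its Jacobian at \<open>y\<close> is \<open>\<mu> (sgn y)\<close> to the power \<open>n - 1\<close>, and the change of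
  variables in the punctured ball is the one on the sphere. That \<open>g\<close> is an involution gives at once
  that it permutes the punctured ball.
\<close>
lemma sphere_integral_conformal_involution_wellorder:
  fixes g :: "real ^ 'm::{finite,wellorder} \<Rightarrow> real ^ 'm::_" and f \<mu> :: "real ^ 'm::_ \<Rightarrow> real"
  assumes meas [measurable]: "g \<in> borel \<rightarrow>\<^sub>M borel" "\<mu> \<in> borel_measurable borel" "f \<in> borel_measurable borel"
    and bound: "\<And>\<zeta>. norm \<zeta> = 1 \<Longrightarrow> \<bar>f \<zeta>\<bar> \<le> B"
    and norm_g: "\<And>y. norm (g y) = norm y"
    and hom: "\<And>y. y \<noteq> 0 \<Longrightarrow> sgn (g y) = g (sgn y)"
    and inv: "\<And>y. g (g y) = y"
    and der: "\<And>y. y \<noteq> 0 \<Longrightarrow> (g has_derivative g' y) (at y)"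
    and \<mu>: "\<And>\<zeta>. norm \<zeta> = 1 \<Longrightarrow> \<mu> \<zeta> > 0"
    and conformal: "\<And>y h. y \<noteq> 0 \<Longrightarrow> (norm (g' y h))\<^sup>2 =
        (h \<bullet> sgn y)\<^sup>2 + (\<mu> (sgn y))\<^sup>2 * ((norm h)\<^sup>2 - (h \<bullet> sgn y)\<^sup>2)"
  shows "(\<integral>\<zeta>. \<mu> \<zeta> ^ (CARD('m) - 1) * f (g \<zeta>) \<partial>sphere_measure) = (\<integral>\<zeta>. f \<zeta> \<partial>sphere_measure)"
proof -
  let ?S = "ball (0 :: real ^ 'm::_) 1 - {0}"
  let ?N = "CARD('m) - 1"
  have [measurable]: "(sgn :: real ^ 'm::_ \<Rightarrow> real ^ 'm::_) \<in> borel \<rightarrow>\<^sub>M borel"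
    unfolding sgn_div_norm by measurable
  have [measurable]: "?S \<in> sets borel" by simp
  have zero: "g y = 0 \<longleftrightarrow> y = 0" for y using norm_g[of y] by (metis norm_eq_zero)
  have image: "g ` ?S = ?S"
  proof
    show sub: "g ` ?S \<subseteq> ?S" by (auto simp: norm_g zero)
    show "?S \<subseteq> g ` ?S"
    proof
      fix y assume "y \<in> ?S"
      then have "g y \<in> ?S" using sub by blast
      then show "y \<in> g ` ?S" using inv[of y] by (metis imageI)
    qed
  qed
  have inj: "inj_on g ?S" using inv by (metis inj_onI)
  have det: "\<bar>det (matrix (g' y))\<bar> = \<mu> (sgn y) ^ ?N" if "y \<noteq> 0" for y
    using that der[OF that] conformal[OF that] \<mu>[of "sgn y"]
    by (intro abs_det_radial_isometry[where s = "sgn y"])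
       (auto simp: norm_sgn dest: has_derivative_linear)
  let ?F = "\<lambda>y. f (sgn y)"
  let ?G = "\<lambda>y. \<mu> (sgn y) ^ ?N * f (g (sgn y))"
  have F: "set_integrable lborel ?S ?F"
    unfolding set_integrable_def
  proof (rule integrableI_bounded_set_indicator[where B = B])
    show "emeasure lborel ?S < \<infinity>"
      using emeasure_mono[of ?S "ball 0 1" lborel] emeasure_lborel_ball_finite[of "0 :: real ^ 'm::_" 1]
      by (auto intro: le_less_trans)
    show "AE y in lborel. y \<in> ?S \<longrightarrow> norm (f (sgn y)) \<le> B"
      by (auto intro!: AE_I2 bound simp: norm_sgn)
  qed auto
  have D: "\<bar>det (matrix (g' y))\<bar> * ?F (g y) = ?G y" if "y \<in> ?S" for y
    using that det[of y] hom[of y] by auto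
  have "?F absolutely_integrable_on g ` ?S"
    unfolding image set_integrable_def using F
    by (subst integrable_completion) (auto simp: set_integrable_def)
  then have "(\<lambda>y. \<bar>det (matrix (g' y))\<bar> * ?F (g y)) absolutely_integrable_on ?S \<and>
      integral ?S (\<lambda>y. \<bar>det (matrix (g' y))\<bar> * ?F (g y)) = integral (g ` ?S) ?F"
    using der inj by (subst has_absolute_integral_change_of_variables_scalar)
       (auto intro: has_derivative_at_withinI)
  moreover have "(\<lambda>y. \<bar>det (matrix (g' y))\<bar> * ?F (g y)) absolutely_integrable_on ?S
      \<longleftrightarrow> ?G absolutely_integrable_on ?S"
    by (rule set_integrable_cong[OF refl refl]) (rule D)
  moreover have "integral ?S (\<lambda>y. \<bar>det (matrix (g' y))\<bar> * ?F (g y)) = integral ?S ?G"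
    by (rule Henstock_Kurzweil_Integration.integral_cong) (rule D)
  ultimately have G: "?G absolutely_integrable_on ?S" and eq: "integral ?S ?G = integral ?S ?F"
    by (simp_all only: image)
  have "set_integrable lborel ?S ?G"
    using G unfolding set_integrable_def by (subst (asm) integrable_completion) auto
  then have "(LINT y:?S|lborel. ?G y) = (LINT y:?S|lborel. ?F y)"
    using eq F by (simp only: set_borel_integral_eq_integral)
  then show ?thesis
    by (simp add: integral_sphere_measure set_lebesgue_integral_def)
qed

text \<open>
  The hypotheses mention norms and inner products only, so conjugation with \<open>reindex\<close> preserves them.
\<close>
theorem sphere_integral_conformal_involution:
  fixes g :: "real ^ 'n \<Rightarrow> real ^ 'n" and f \<mu> :: "real ^ 'n \<Rightarrow> real"
  assumes meas [measurable]: "g \<in> borel \<rightarrow>\<^sub>M borel" "\<mu> \<in> borel_measurable borel" "f \<in> borel_measurable borel"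
    and bound: "\<And>\<zeta>. norm \<zeta> = 1 \<Longrightarrow> \<bar>f \<zeta>\<bar> \<le> B"
    and norm_g: "\<And>y. norm (g y) = norm y"
    and hom: "\<And>y. y \<noteq> 0 \<Longrightarrow> sgn (g y) = g (sgn y)"
    and inv: "\<And>y. g (g y) = y"
    and der: "\<And>y. y \<noteq> 0 \<Longrightarrow> (g has_derivative g' y) (at y)"
    and \<mu>: "\<And>\<zeta>. norm \<zeta> = 1 \<Longrightarrow> \<mu> \<zeta> > 0"
    and conformal: "\<And>y h. y \<noteq> 0 \<Longrightarrow> (norm (g' y h))\<^sup>2 =
        (h \<bullet> sgn y)\<^sup>2 + (\<mu> (sgn y))\<^sup>2 * ((norm h)\<^sup>2 - (h \<bullet> sgn y)\<^sup>2)"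
  shows "(\<integral>\<zeta>. \<mu> \<zeta> ^ (CARD('n) - 1) * f (g \<zeta>) \<partial>sphere_measure) = (\<integral>\<zeta>. f \<zeta> \<partial>sphere_measure)"
proof -
  obtain b :: "'n index \<Rightarrow> 'n" where b: "bij b"
    using finite_same_card_bij[of "UNIV :: 'n index set" "UNIV :: 'n set"] card_index[where 'a = 'n] by auto
  let ?r = "reindex b" and ?r' = "reindex (inv b)"
  have b': "bij (inv b)" using b by (rule bij_imp_bij_inv)
  note [simp] = norm_reindex[OF b] norm_reindex[OF b'] reindex_inv[OF b]
  have lin: "linear ?r" "linear ?r'" by (rule linear_reindex)+
  then have bl: "bounded_linear ?r" "bounded_linear ?r'"
    by (simp_all add: linear_conv_bounded_linear)
  have sgn: "sgn (?r y) = ?r (sgn y)" "sgn (?r' z) = ?r' (sgn z)" for y z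
    by (simp_all add: sgn_div_norm linear_scale[OF lin(1)] linear_scale[OF lin(2)])
  have inner': "?r' z \<bullet> y = z \<bullet> ?r y" for y z
    using inner_reindex[OF b, of "?r' z" y] by simp
  have zero: "?r' z = 0 \<longleftrightarrow> z = 0" for z
    using norm_reindex[OF b', of z] by (metis norm_eq_zero)
  let ?\<mu> = "\<lambda>z. \<mu> (?r' z)" and ?f = "\<lambda>z. f (?r' z)" and ?g = "\<lambda>z. ?r (g (?r' z))"
  let ?g' = "\<lambda>z h. ?r (g' (?r' z) (?r' h))"
  have "(\<integral>\<zeta>. ?\<mu> \<zeta> ^ (CARD('n index) - 1) * ?f (?g \<zeta>) \<partial>sphere_measure) = (\<integral>\<zeta>. ?f \<zeta> \<partial>sphere_measure)"
  proof (rule sphere_integral_conformal_involution_wellorder[where B = B and g' = ?g'])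
    fix z h :: "real ^ 'n index" assume z: "z \<noteq> 0"
    show "(?g has_derivative ?g' z) (at z)"
    proof (rule bounded_linear.has_derivative[OF bl(1)])
      have "(g \<circ> ?r' has_derivative g' (?r' z) \<circ> ?r') (at z)"
        using z bl(2) by (intro diff_chain_at der bounded_linear_imp_has_derivative) (simp_all add: zero)
      then show "((\<lambda>z. g (?r' z)) has_derivative (\<lambda>h. g' (?r' z) (?r' h))) (at z)"
        by (simp add: o_def)
    qed
    show "(norm (?g' z h))\<^sup>2 =
        (h \<bullet> sgn z)\<^sup>2 + (?\<mu> (sgn z))\<^sup>2 * ((norm h)\<^sup>2 - (h \<bullet> sgn z)\<^sup>2)"
      using conformal[of "?r' z" "?r' h"] z by (simp add: zero sgn inner')
  qed (use bound \<mu> in \<open>auto simp: norm_g inv hom zero sgn\<close>)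
  then have "(\<integral>\<zeta>. \<mu> (?r' \<zeta>) ^ (CARD('n) - 1) * f (g (?r' \<zeta>)) \<partial>sphere_measure) = (\<integral>\<zeta>. f (?r' \<zeta>) \<partial>sphere_measure)"
    by (simp add: card_index)
  then show ?thesis
    by (subst (asm) (1 2) integral_sphere_measure_reindex[OF b']) auto
qed

section \<open>Chords through an interior point\<close>

text \<open>
  For a unit vector \<open>y\<close> this is the second point of the sphere on the line through \<open>y\<close> and \<open>x\<close>; the
  powers of \<open>norm y\<close> make the extension to the whole space homogeneous of degree 1.
\<close>
definition chord_map :: "real ^ 'n \<Rightarrow> real ^ 'n \<Rightarrow> real ^ 'n" where
  "chord_map x y = norm y *\<^sub>R x -
     ((1 - (norm x)\<^sup>2) * (norm y)\<^sup>2 / (norm (y - norm y *\<^sub>R x))\<^sup>2) *\<^sub>R (y - norm y *\<^sub>R x)"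

text \<open>
  The power of the point \<open>x\<close> is \<open>1 - (norm x)\<^sup>2\<close>, so this is the ratio in which \<open>x\<close> divides the
  chord through \<open>\<zeta>\<close>; it is also the conformal factor of \<open>chord_map x\<close> at \<open>\<zeta>\<close>.
\<close>
definition chord_ratio :: "real ^ 'n \<Rightarrow> real ^ 'n \<Rightarrow> real" where
  "chord_ratio x \<zeta> = (1 - (norm x)\<^sup>2) / (norm (x - \<zeta>))\<^sup>2"

lemma chord_map_sphere:
  assumes "norm \<zeta> = 1"
  shows "chord_map x \<zeta> = x - chord_ratio x \<zeta> *\<^sub>R (\<zeta> - x)"
  using assms by (simp add: chord_map_def chord_ratio_def norm_minus_commute)

lemma chord_map_scaleR:
  assumes "0 \<le> c"
  shows "chord_map x (c *\<^sub>R y) = c *\<^sub>R chord_map x y"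
proof (cases "c = 0")
  case False
  define w where "w = y - norm y *\<^sub>R x"
  have gap: "c *\<^sub>R y - norm (c *\<^sub>R y) *\<^sub>R x = c *\<^sub>R w"
    using assms by (simp add: w_def algebra_simps)
  show ?thesis
    unfolding chord_map_def gap w_def[symmetric] using False assms
    by (simp add: power_mult_distrib scaleR_diff_right)
qed (simp add: chord_map_def)

lemma measurable_chord_map [measurable]: "chord_map x \<in> borel \<rightarrow>\<^sub>M borel"
  unfolding chord_map_def[abs_def] by measurable

lemma measurable_chord_ratio [measurable]: "chord_ratio x \<in> borel_measurable borel"
  unfolding chord_ratio_def[abs_def] by measurable

context
  fixes x :: "real ^ 'n"
  assumes x: "norm x < 1"
begin

lemma chord_gap_pos:
  assumes "norm \<zeta> = 1"
  shows "0 < (norm (\<zeta> - x))\<^sup>2"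
  using assms x by auto

lemma one_minus_norm_pos: "0 < 1 - (norm x)\<^sup>2"
  using x by (simp add: power_less_one_iff abs_square_less_1)

lemma chord_ratio_pos: "norm \<zeta> = 1 \<Longrightarrow> 0 < chord_ratio x \<zeta>"
  using chord_gap_pos[of \<zeta>] one_minus_norm_pos by (auto simp: chord_ratio_def norm_minus_commute)

lemma chord_ratio_mult_gap:
  "norm \<zeta> = 1 \<Longrightarrow> chord_ratio x \<zeta> * (norm (\<zeta> - x))\<^sup>2 = 1 - (norm x)\<^sup>2"
  using chord_gap_pos[of \<zeta>] by (simp add: chord_ratio_def norm_minus_commute)

lemma two_inner_chord:
  assumes "norm \<zeta> = 1"
  shows "2 * (x \<bullet> (\<zeta> - x)) = (chord_ratio x \<zeta> - 1) * (norm (\<zeta> - x))\<^sup>2"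
proof -
  have "\<zeta> \<bullet> \<zeta> = 1" using assms by (simp add: dot_square_norm)
  then show ?thesis
    unfolding left_diff_distrib chord_ratio_mult_gap[OF assms]
    by (simp add: power2_norm_eq_inner inner_diff_left inner_diff_right inner_commute)
qed

lemma norm_chord_map_sphere:
  assumes "norm \<zeta> = 1"
  shows "norm (chord_map x \<zeta>) = 1"
proof -
  let ?c = "chord_ratio x \<zeta>"
  have "(norm (chord_map x \<zeta>))\<^sup>2 = (norm x)\<^sup>2 - ?c * (2 * (x \<bullet> (\<zeta> - x))) + ?c\<^sup>2 * (norm (\<zeta> - x))\<^sup>2"
    unfolding chord_map_sphere[OF assms] power2_norm_eq_inner
    by (simp add: inner_diff_left inner_diff_right inner_commute power2_eq_square algebra_simps)
  also have "\<dots> = (norm x)\<^sup>2 + ?c * (norm (\<zeta> - x))\<^sup>2"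
    unfolding two_inner_chord[OF assms] by (simp add: algebra_simps power2_eq_square)
  also have "\<dots> = 1" unfolding chord_ratio_mult_gap[OF assms] by simp
  finally show ?thesis by (simp add: power2_eq_1_iff) (use norm_ge_zero[of "chord_map x \<zeta>"] in linarith)
qed

lemma norm_chord_map: "norm (chord_map x y) = norm y"
proof (cases "y = 0")
  case False
  have "chord_map x y = norm y *\<^sub>R chord_map x (sgn y)"
    using chord_map_scaleR[of "norm y" x "sgn y"] by (simp add: sgn_div_norm False)
  then show ?thesis using False norm_chord_map_sphere[of "sgn y"] by (simp add: norm_sgn)
qed (simp add: chord_map_def)

lemma norm_diff_chord_map:
  assumes "norm \<zeta> = 1"
  shows "(norm (x - chord_map x \<zeta>))\<^sup>2 = (1 - (norm x)\<^sup>2) * chord_ratio x \<zeta>"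
proof -
  have "(norm (x - chord_map x \<zeta>))\<^sup>2 = (chord_ratio x \<zeta>)\<^sup>2 * (norm (\<zeta> - x))\<^sup>2"
    by (simp add: chord_map_sphere[OF assms] power_mult_distrib)
  also have "\<dots> = chord_ratio x \<zeta> * (chord_ratio x \<zeta> * (norm (\<zeta> - x))\<^sup>2)"
    by (simp add: power2_eq_square)
  finally show ?thesis unfolding chord_ratio_mult_gap[OF assms] by simp
qed

text \<open>
  The two end points of a chord see it divided in inverse ratios. This is what turns the powers of the
  kernel that remain after the substitution into powers of the distance to \<open>x\<close>.
\<close>
lemma chord_ratio_chord_map:
  assumes "norm \<zeta> = 1"
  shows "chord_ratio x (chord_map x \<zeta>) = 1 / chord_ratio x \<zeta>"
  using one_minus_norm_pos unfolding chord_ratio_def[of x "chord_map x \<zeta>"] norm_diff_chord_map[OF assms]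
  by simp

lemma chord_map_involution: "chord_map x (chord_map x y) = y"
proof (cases "y = 0")
  case False
  have s: "norm (sgn y) = 1" using False by (simp add: norm_sgn)
  have "chord_map x (chord_map x (sgn y)) = sgn y"
    using chord_ratio_pos[OF s]
    by (simp add: chord_map_sphere[OF norm_chord_map_sphere[OF s]] chord_ratio_chord_map[OF s])
       (simp add: chord_map_sphere[OF s])
  then show ?thesis
    using chord_map_scaleR[of "norm y" x "sgn y"] chord_map_scaleR[of "norm y" x "chord_map x (sgn y)"]
    by (simp add: sgn_div_norm False)
qed (simp add: chord_map_def)

lemma sgn_chord_map: "sgn (chord_map x y) = chord_map x (sgn y)"
  using chord_map_scaleR[of "inverse (norm y)" x y] by (simp add: sgn_div_norm norm_chord_map)

text \<open>
  The derivative of \<open>chord_map x\<close>, written in terms of the radial part \<open>a\<close> of the increment \<open>h\<close> and the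
  increment \<open>k\<close> of \<open>y - norm y *\<^sub>R x\<close>.
\<close>
definition chord_deriv :: "real ^ 'n \<Rightarrow> real ^ 'n \<Rightarrow> real ^ 'n" where
  "chord_deriv y h =
    (let s = sgn y; v = s - x; a = h \<bullet> s; k = h - a *\<^sub>R x in
     a *\<^sub>R x - chord_ratio x s *\<^sub>R (k + (2 * a - 2 * (v \<bullet> k) / (norm v)\<^sup>2) *\<^sub>R v))"

text \<open>
  In terms of the tangential part \<open>t\<close> of the increment, the derivative sends the radial direction to
  the image point and acts on \<open>t\<close> as the reflection along the chord, up to the factor
  \<open>- chord_ratio x s\<close>. This displays the conformality.
\<close>
lemma chord_deriv_eq:
  fixes s y h :: "real ^ 'n"
  assumes "norm s = 1" and s: "s = sgn y"
  defines "t \<equiv> h - (h \<bullet> s) *\<^sub>R s"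
  shows "chord_deriv y h = (h \<bullet> s) *\<^sub>R chord_map x s
     - chord_ratio x s *\<^sub>R (t - (2 * ((s - x) \<bullet> t) / (norm (s - x))\<^sup>2) *\<^sub>R (s - x))"
proof -
  let ?v = "s - x" and ?a = "h \<bullet> s"
  have pos: "(norm ?v)\<^sup>2 \<noteq> 0" using chord_gap_pos[OF assms(1)] by simp
  have k: "h - ?a *\<^sub>R x = t + ?a *\<^sub>R ?v" by (simp add: t_def algebra_simps)
  have "?v \<bullet> (t + ?a *\<^sub>R ?v) = ?v \<bullet> t + ?a * (norm ?v)\<^sup>2"
    by (simp add: inner_add_right power2_norm_eq_inner)
  then have coeff: "2 * ?a - 2 * (?v \<bullet> (t + ?a *\<^sub>R ?v)) / (norm ?v)\<^sup>2 = - (2 * (?v \<bullet> t) / (norm ?v)\<^sup>2)"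
    using pos by (simp add: add_divide_distrib distrib_left)
  show ?thesis
    unfolding chord_deriv_def Let_def s[symmetric] k coeff chord_map_sphere[OF assms(1)]
    by (simp add: algebra_simps)
qed

text \<open>
  The reflected tangential part \<open>r\<close> is orthogonal to the image point \<open>T\<close>, because the same
  reflection takes the unit vector \<open>s\<close> to \<open>T\<close>, so Pythagoras applies.
\<close>
lemma norm_chord_deriv:
  assumes "y \<noteq> 0"
  shows "(norm (chord_deriv y h))\<^sup>2 =
    (h \<bullet> sgn y)\<^sup>2 + (chord_ratio x (sgn y))\<^sup>2 * ((norm h)\<^sup>2 - (h \<bullet> sgn y)\<^sup>2)"
proof -
  define s where "s = sgn y"
  define v where "v = s - x"
  define a where "a = h \<bullet> s"
  define t where "t = h - a *\<^sub>R s"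
  define c where "c = chord_ratio x s"
  define T where "T = chord_map x s"
  define r where "r = t - (2 * (v \<bullet> t) / (norm v)\<^sup>2) *\<^sub>R v"
  have s: "norm s = 1" using assms by (simp add: s_def norm_sgn)
  have vv: "v \<bullet> v \<noteq> 0" using chord_gap_pos[OF s] by (simp add: v_def)
  have st: "s \<bullet> t = 0" using s by (simp add: t_def a_def inner_diff_right inner_commute dot_square_norm)
  have TT: "T \<bullet> T = 1" using norm_chord_map_sphere[OF s] by (simp add: T_def dot_square_norm)
  have rr: "r \<bullet> r = t \<bullet> t"
    using vv by (simp add: r_def inner_diff_left inner_diff_right inner_commute power2_norm_eq_inner)
  have tt: "t \<bullet> t = (norm h)\<^sup>2 - a\<^sup>2"
    using s unfolding power2_norm_eq_inner t_def inner_diff_left inner_diff_right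
    by (simp add: inner_commute a_def dot_square_norm) (simp add: power2_eq_square)
  have xt: "x \<bullet> t = - (v \<bullet> t)" using st by (simp add: v_def inner_diff_left)
  have xv: "2 * (x \<bullet> v) = (c - 1) * (v \<bullet> v)"
    using two_inner_chord[OF s] by (simp add: v_def c_def power2_norm_eq_inner)
  have "T \<bullet> r = x \<bullet> t - c * (v \<bullet> t) - (v \<bullet> t) * (2 * (x \<bullet> v)) / (v \<bullet> v) + 2 * c * (v \<bullet> t)"
    using vv by (simp add: T_def chord_map_sphere[OF s] r_def v_def[symmetric] c_def[symmetric]
        inner_diff_left inner_diff_right power2_norm_eq_inner field_simps)
  also have "\<dots> = 0" unfolding xt xv using vv by (simp add: field_simps)
  finally have Tr: "T \<bullet> r = 0" .
  have eq: "chord_deriv y h = a *\<^sub>R T - c *\<^sub>R r"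
    using chord_deriv_eq[OF s s_def] by (simp add: a_def T_def c_def r_def t_def v_def)
  have "(norm (chord_deriv y h))\<^sup>2 = a\<^sup>2 * (T \<bullet> T) - 2 * a * c * (T \<bullet> r) + c\<^sup>2 * (r \<bullet> r)"
    unfolding eq power2_norm_eq_inner
    by (simp add: inner_diff_left inner_diff_right inner_commute[of r T] power2_eq_square
        algebra_simps)
  then show ?thesis unfolding TT Tr rr tt by (simp add: a_def c_def s_def)
qed

lemma has_derivative_chord_map:
  assumes y: "y \<noteq> 0"
  shows "(chord_map x has_derivative chord_deriv y) (at y)"
proof -
  define s where "s = sgn y"
  define v where "v = s - x"
  define r where "r = norm y"
  have s: "norm s = 1" using assms by (simp add: s_def norm_sgn)
  have vv: "v \<bullet> v \<noteq> 0" using chord_gap_pos[OF s] by (simp add: v_def)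
  have r: "r > 0" using y by (simp add: r_def)
  let ?w = "\<lambda>y. y - norm y *\<^sub>R x"
  have w: "?w y = r *\<^sub>R v" using r by (simp add: r_def v_def s_def sgn_div_norm algebra_simps)
  have dn: "(norm has_derivative (\<lambda>h. h \<bullet> s)) (at y)"
    using has_derivative_norm[OF y] by (simp add: s_def inner_commute)
  have dw: "(?w has_derivative (\<lambda>h. h - (h \<bullet> s) *\<^sub>R x)) (at y)"
    by (intro derivative_intros dn)
  let ?N = "1 - (norm x)\<^sup>2"
  let ?k = "\<lambda>h. h - (h \<bullet> s) *\<^sub>R x"
  have dq: "((\<lambda>y. ?w y \<bullet> ?w y) has_derivative (\<lambda>h. 2 * r * (v \<bullet> ?k h))) (at y)"
    by (rule has_derivative_eq_rhs[OF has_derivative_inner[OF dw dw]])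
       (simp add: w inner_commute fun_eq_iff)
  have dm: "((\<lambda>y. ?N * (norm y)\<^sup>2) has_derivative (\<lambda>h. ?N * (2 * r * (h \<bullet> s)))) (at y)"
    unfolding power2_eq_square[of "norm y" for y]
    by (rule has_derivative_eq_rhs[OF has_derivative_mult_right[OF has_derivative_mult[OF dn dn]]])
       (simp add: r_def fun_eq_iff)
  have q: "?w y \<bullet> ?w y = r\<^sup>2 * (v \<bullet> v)" unfolding w by (simp add: power2_eq_square)
  have m: "?N * (norm y)\<^sup>2 = ?N * r\<^sup>2" by (simp add: r_def)
  have c: "chord_ratio x s = ?N / (v \<bullet> v)"
    by (simp add: chord_ratio_def v_def power2_norm_eq_inner[symmetric] norm_minus_commute)
  have "((\<lambda>y. norm y *\<^sub>R x - (?N * (norm y)\<^sup>2 / (?w y \<bullet> ?w y)) *\<^sub>R ?w y)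
     has_derivative chord_deriv y) (at y)"
  proof (rule has_derivative_eq_rhs)
    show "((\<lambda>y. norm y *\<^sub>R x - (?N * (norm y)\<^sup>2 / (?w y \<bullet> ?w y)) *\<^sub>R ?w y)
       has_derivative (\<lambda>h. (h \<bullet> s) *\<^sub>R x -
         ((?N * (norm y)\<^sup>2 / (?w y \<bullet> ?w y)) *\<^sub>R ?k h +
          ((?N * (2 * r * (h \<bullet> s)) * (?w y \<bullet> ?w y) - ?N * (norm y)\<^sup>2 * (2 * r * (v \<bullet> ?k h)))
            / ((?w y \<bullet> ?w y) * (?w y \<bullet> ?w y))) *\<^sub>R ?w y))) (at y)"
      using r vv q
      by (intro has_derivative_diff has_derivative_scaleR has_derivative_divide' dm dq dw
          has_derivative_scaleR_left dn) auto
    show "(\<lambda>h. (h \<bullet> s) *\<^sub>R x -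
         ((?N * (norm y)\<^sup>2 / (?w y \<bullet> ?w y)) *\<^sub>R ?k h +
          ((?N * (2 * r * (h \<bullet> s)) * (?w y \<bullet> ?w y) - ?N * (norm y)\<^sup>2 * (2 * r * (v \<bullet> ?k h)))
            / ((?w y \<bullet> ?w y) * (?w y \<bullet> ?w y))) *\<^sub>R ?w y)) = chord_deriv y"
    proof
      fix h
      have 1: "?N * r\<^sup>2 / (r\<^sup>2 * (v \<bullet> v)) = chord_ratio x s"
        using r by (simp add: c)
      have quot: "(N * (2 * r * a) * (r\<^sup>2 * q) - N * r\<^sup>2 * (2 * r * b)) / ((r\<^sup>2 * q) * (r\<^sup>2 * q)) * r
          = N / q * (2 * a - 2 * b / q)" if "q \<noteq> 0" for N a b q :: real
        using r that by (simp add: field_simps power2_eq_square)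
      note 2 = quot[OF vv, of ?N "h \<bullet> s" "v \<bullet> ?k h", folded c]
      have deriv: "chord_deriv y h = (h \<bullet> s) *\<^sub>R x -
          chord_ratio x s *\<^sub>R (?k h + (2 * (h \<bullet> s) - 2 * (v \<bullet> ?k h) / (v \<bullet> v)) *\<^sub>R v)"
        by (simp only: chord_deriv_def Let_def s_def[symmetric] v_def[symmetric] power2_norm_eq_inner)
      show "(h \<bullet> s) *\<^sub>R x -
         ((?N * (norm y)\<^sup>2 / (?w y \<bullet> ?w y)) *\<^sub>R ?k h +
          ((?N * (2 * r * (h \<bullet> s)) * (?w y \<bullet> ?w y) - ?N * (norm y)\<^sup>2 * (2 * r * (v \<bullet> ?k h)))
            / ((?w y \<bullet> ?w y) * (?w y \<bullet> ?w y))) *\<^sub>R ?w y) = chord_deriv y h"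
        unfolding q m deriv unfolding w scaleR_scaleR 1 2
        by (simp add: scaleR_add_right)
    qed
  qed
  then show ?thesis
    unfolding chord_map_def[abs_def] power2_norm_eq_inner[of "_ - _"] .
qed

text \<open>
  The Jacobian of the chord map is the hyperbolic Poisson kernel.
\<close>
theorem sphere_integral_chord_map:
  assumes [measurable]: "f \<in> borel_measurable borel"
    and bound: "\<And>\<zeta>. norm \<zeta> = 1 \<Longrightarrow> \<bar>f \<zeta>\<bar> \<le> B"
  shows "(\<integral>\<zeta>. chord_ratio x \<zeta> ^ (CARD('n) - 1) * f (chord_map x \<zeta>) \<partial>sphere_measure) = (\<integral>\<zeta>. f \<zeta> \<partial>sphere_measure)"
  by (rule sphere_integral_conformal_involution[where g' = chord_deriv and B = B])
     (auto intro: bound norm_chord_map sgn_chord_map chord_map_involution has_derivative_chord_map chord_ratio_pos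
       norm_chord_deriv)

end

text \<open>
  An isometry is the case of conformal factor 1.
\<close>
lemma sphere_integral_orthogonal_involution:
  fixes R :: "real ^ 'n \<Rightarrow> real ^ 'n" and f :: "real ^ 'n \<Rightarrow> real"
  assumes [measurable]: "f \<in> borel_measurable borel"
    and bound: "\<And>\<zeta>. norm \<zeta> = 1 \<Longrightarrow> \<bar>f \<zeta>\<bar> \<le> B"
    and R: "linear R" "\<And>y. norm (R y) = norm y" "\<And>y. R (R y) = y"
  shows "(\<integral>\<zeta>. f (R \<zeta>) \<partial>sphere_measure) = (\<integral>\<zeta>. f \<zeta> \<partial>sphere_measure)"
proof -
  have bl: "bounded_linear R" using R(1) by (simp add: linear_conv_bounded_linear)
  have [measurable]: "R \<in> borel \<rightarrow>\<^sub>M borel"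
    by (intro borel_measurable_continuous_onI linear_continuous_on bl)
  have "(\<integral>\<zeta>. (\<lambda>_. 1) \<zeta> ^ (CARD('n) - 1) * f (R \<zeta>) \<partial>sphere_measure) = (\<integral>\<zeta>. f \<zeta> \<partial>sphere_measure)"
    by (rule sphere_integral_conformal_involution[where g' = "\<lambda>_. R" and B = B])
       (auto simp: bound R sgn_div_norm linear_scale[OF R(1)] intro: bounded_linear_imp_has_derivative bl)
  then show ?thesis by simp
qed

section \<open>Comparison of zonal moments by reflections\<close>

text \<open>
  For \<open>a = b\<close> division by zero makes this the identity, so no case distinction is needed when two
  directions happen to coincide.
\<close>
definition swap_reflection :: "'a::real_inner \<Rightarrow> 'a \<Rightarrow> 'a \<Rightarrow> 'a" where
  "swap_reflection a b y = y - (2 * ((a - b) \<bullet> y) / (norm (a - b))\<^sup>2) *\<^sub>R (a - b)"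

lemma linear_swap_reflection: "linear (swap_reflection a b)"
proof (rule linearI)
  show "swap_reflection a b (y + z) = swap_reflection a b y + swap_reflection a b z" for y z
    by (simp add: swap_reflection_def inner_add_right distrib_left add_divide_distrib scaleR_add_left)
  show "swap_reflection a b (c *\<^sub>R y) = c *\<^sub>R swap_reflection a b y" for c y
    by (simp add: swap_reflection_def scaleR_diff_right mult.left_commute)
qed

lemma inner_swap_reflection:
  "swap_reflection a b y \<bullet> z = y \<bullet> z - 2 * ((a - b) \<bullet> y) * ((a - b) \<bullet> z) / (norm (a - b))\<^sup>2"
  by (simp add: swap_reflection_def inner_diff_left)

lemma inner_swap_reflection_adjoint: "swap_reflection a b y \<bullet> z = y \<bullet> swap_reflection a b z"
  by (simp add: inner_swap_reflection inner_commute[of y] mult.commute mult.left_commute)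

lemma swap_reflection_involution: "swap_reflection a b (swap_reflection a b y) = y"
proof (cases "a = b")
  case False
  define u where "u = a - b"
  have u: "u \<bullet> u \<noteq> 0" using False by (simp add: u_def)
  show ?thesis
    unfolding swap_reflection_def u_def[symmetric] power2_norm_eq_inner using u
    by (simp add: inner_diff_right)
qed (simp add: swap_reflection_def)

lemma norm_swap_reflection: "norm (swap_reflection a b y) = norm y"
  by (metis inner_swap_reflection_adjoint norm_eq_sqrt_inner swap_reflection_involution)

lemma swap_reflection_swaps:
  assumes "norm a = norm b"
  shows "swap_reflection a b a = b"
proof (cases "a = b")
  case False
  have "a \<bullet> a = b \<bullet> b" using assms by (simp add: norm_eq)
  then have "(norm (a - b))\<^sup>2 = 2 * ((a - b) \<bullet> a)"
    by (simp add: power2_norm_eq_inner inner_diff_left inner_diff_right inner_commute)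
  moreover have "(norm (a - b))\<^sup>2 \<noteq> 0" using False by simp
  ultimately show ?thesis by (simp add: swap_reflection_def)
qed (simp add: swap_reflection_def)

lemma swap_reflection_fixes: "a \<bullet> y = b \<bullet> y \<Longrightarrow> swap_reflection a b y = y"
  by (simp add: swap_reflection_def inner_diff_left)

text \<open>
  A two-point rearrangement: the integral of the nonnegative function in the last hypothesis is twice
  the difference of the two sides, because \<open>R\<close> preserves the measure.
\<close>
lemma sphere_integral_involution_rearrangement:
  fixes R :: "real ^ 'n \<Rightarrow> real ^ 'n" and f g :: "real ^ 'n \<Rightarrow> real"
  assumes [measurable]: "f \<in> borel_measurable borel" "g \<in> borel_measurable borel"
    and f: "\<And>\<zeta>. norm \<zeta> = 1 \<Longrightarrow> \<bar>f \<zeta>\<bar> \<le> A" and g: "\<And>\<zeta>. norm \<zeta> = 1 \<Longrightarrow> \<bar>g \<zeta>\<bar> \<le> B"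
    and R: "linear R" "\<And>y. norm (R y) = norm y" "\<And>y. R (R y) = y"
    and ordered: "\<And>\<zeta>. norm \<zeta> = 1 \<Longrightarrow> 0 \<le> (f \<zeta> - f (R \<zeta>)) * (g \<zeta> - g (R \<zeta>))"
  shows "(\<integral>\<zeta>. f \<zeta> * g (R \<zeta>) \<partial>sphere_measure) \<le> (\<integral>\<zeta>. f \<zeta> * g \<zeta> \<partial>sphere_measure)"
proof -
  have [measurable]: "R \<in> borel \<rightarrow>\<^sub>M borel"
    using R(1) by (intro borel_measurable_continuous_onI linear_continuous_on) (simp add: linear_conv_bounded_linear)
  have bound: "\<bar>f \<zeta> * g \<xi>\<bar> \<le> A * B" if "norm \<zeta> = 1" "norm \<xi> = 1" for \<zeta> \<xi>
    unfolding abs_mult using f[OF that(1)] g[OF that(2)] by (intro mult_mono) auto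
  let ?I = "\<lambda>h. \<integral>\<zeta>. h \<zeta> \<partial>(sphere_measure :: (real ^ 'n) measure)"
  have int: "integrable sphere_measure (\<lambda>\<zeta>. f \<zeta> * g \<zeta>)" "integrable sphere_measure (\<lambda>\<zeta>. f \<zeta> * g (R \<zeta>))"
    "integrable sphere_measure (\<lambda>\<zeta>. f (R \<zeta>) * g \<zeta>)" "integrable sphere_measure (\<lambda>\<zeta>. f (R \<zeta>) * g (R \<zeta>))"
    by (rule integrable_sphere_measure_bounded[where B = "A * B"]; simp add: bound R)+
  have "0 \<le> ?I (\<lambda>\<zeta>. (f \<zeta> - f (R \<zeta>)) * (g \<zeta> - g (R \<zeta>)))"
    by (intro integral_nonneg_AE AE_I2) (simp add: space_sphere_measure ordered)
  also have "\<dots> = ?I (\<lambda>\<zeta>. (f \<zeta> * g \<zeta> - f \<zeta> * g (R \<zeta>)) - (f (R \<zeta>) * g \<zeta> - f (R \<zeta>) * g (R \<zeta>)))"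
    by (simp add: algebra_simps)
  also have "\<dots> = (?I (\<lambda>\<zeta>. f \<zeta> * g \<zeta>) - ?I (\<lambda>\<zeta>. f \<zeta> * g (R \<zeta>)))
      - (?I (\<lambda>\<zeta>. f (R \<zeta>) * g \<zeta>) - ?I (\<lambda>\<zeta>. f (R \<zeta>) * g (R \<zeta>)))"
    using int by simp
  also have "?I (\<lambda>\<zeta>. f (R \<zeta>) * g (R \<zeta>)) = ?I (\<lambda>\<zeta>. f \<zeta> * g \<zeta>)"
    using sphere_integral_orthogonal_involution[where R = R and f = "\<lambda>\<zeta>. f \<zeta> * g \<zeta>" and B = "A * B"]
    by (simp add: bound R)
  also have "?I (\<lambda>\<zeta>. f (R \<zeta>) * g \<zeta>) = ?I (\<lambda>\<zeta>. f \<zeta> * g (R \<zeta>))"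
    using sphere_integral_orthogonal_involution[where R = R and f = "\<lambda>\<zeta>. f \<zeta> * g (R \<zeta>)" and B = "A * B"]
    by (simp add: bound R)
  finally show ?thesis by simp
qed

lemma mono_on_unit_bounded:
  fixes F :: "real \<Rightarrow> real"
  assumes "mono_on {0..1} F" "norm (\<zeta> :: 'a::real_inner) = 1" "norm n = 1"
  shows "\<bar>F \<bar>\<zeta> \<bullet> n\<bar>\<bar> \<le> max \<bar>F 0\<bar> \<bar>F 1\<bar>"
proof -
  have "\<bar>\<zeta> \<bullet> n\<bar> \<in> {0..1}" using Cauchy_Schwarz_ineq2[of \<zeta> n] assms by simp
  then show ?thesis
    using mono_onD[OF assms(1), of 0 "\<bar>\<zeta> \<bullet> n\<bar>"] mono_onD[OF assms(1), of "\<bar>\<zeta> \<bullet> n\<bar>" 1] by auto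
qed

lemma mono_on_similarly_ordered:
  fixes F G :: "real \<Rightarrow> real"
  assumes "mono_on S F" "mono_on S G" "a \<in> S" "b \<in> S" "c \<in> S" "d \<in> S" "a \<le> b \<longleftrightarrow> c \<le> d"
    "b \<le> a \<longleftrightarrow> d \<le> c"
  shows "0 \<le> (F a - F b) * (G c - G d)"
proof (cases "a \<le> b")
  case True
  then have "F a \<le> F b" "G c \<le> G d" using assms by (auto dest: mono_onD)
  then show ?thesis by (intro mult_nonpos_nonpos) auto
next
  case False
  then have "b \<le> a" "d \<le> c" using assms by auto
  then have "F b \<le> F a" "G d \<le> G c" using assms by (auto dest: mono_onD)
  then show ?thesis by (intro mult_nonneg_nonneg) auto
qed

lemma abs_inner_unit: "norm \<zeta> = 1 \<Longrightarrow> norm \<xi> = 1 \<Longrightarrow> \<bar>\<zeta> \<bullet> \<xi>\<bar> \<in> {0..1}" for \<zeta> \<xi> :: "real ^ 'n"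
  using Cauchy_Schwarz_ineq2[of \<zeta> \<xi>] by simp

context
  fixes F G :: "real \<Rightarrow> real" and n :: "real ^ 'n"
  assumes F: "mono_on {0..1} F" and G: "mono_on {0..1} G"
    and meas [measurable]: "F \<in> borel_measurable borel" "G \<in> borel_measurable borel"
    and n: "norm n = 1"
begin

text \<open>
  Under the reflection that exchanges \<open>n\<close> and \<open>l\<close>, the functions \<open>F |\<langle>\<zeta>, n\<rangle>|\<close> and \<open>G |\<langle>\<zeta>, n\<rangle>|\<close>
  increase or decrease together.
\<close>
lemma zonal_moment_le_pole:
  assumes l: "norm l = 1"
  shows "(\<integral>\<zeta>. F \<bar>\<zeta> \<bullet> n\<bar> * G \<bar>\<zeta> \<bullet> l\<bar> \<partial>sphere_measure) \<le> (\<integral>\<zeta>. F \<bar>\<zeta> \<bullet> n\<bar> * G \<bar>\<zeta> \<bullet> n\<bar> \<partial>sphere_measure)"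
proof -
  have R: "swap_reflection n l \<zeta> \<bullet> n = \<zeta> \<bullet> l" for \<zeta>
    by (simp add: inner_swap_reflection_adjoint swap_reflection_swaps n l)
  have "0 \<le> (F \<bar>\<zeta> \<bullet> n\<bar> - F \<bar>\<zeta> \<bullet> l\<bar>) * (G \<bar>\<zeta> \<bullet> n\<bar> - G \<bar>\<zeta> \<bullet> l\<bar>)" if "norm \<zeta> = 1" for \<zeta>
    by (intro mono_on_similarly_ordered[OF F G] abs_inner_unit that n l refl)
  then have "(\<integral>\<zeta>. F \<bar>\<zeta> \<bullet> n\<bar> * G \<bar>swap_reflection n l \<zeta> \<bullet> n\<bar> \<partial>sphere_measure)
      \<le> (\<integral>\<zeta>. F \<bar>\<zeta> \<bullet> n\<bar> * G \<bar>\<zeta> \<bullet> n\<bar> \<partial>sphere_measure)"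
    by (intro sphere_integral_involution_rearrangement[where R = "swap_reflection n l"
        and f = "\<lambda>\<zeta>. F \<bar>\<zeta> \<bullet> n\<bar>" and g = "\<lambda>\<zeta>. G \<bar>\<zeta> \<bullet> n\<bar>",
        OF _ _ mono_on_unit_bounded[OF F _ n] mono_on_unit_bounded[OF G _ n]
          linear_swap_reflection norm_swap_reflection swap_reflection_involution])
      (simp_all add: R)
  then show ?thesis unfolding R .
qed

text \<open>
  The reflection that exchanges \<open>t\<close> and \<open>t'\<close> fixes \<open>n\<close>.
\<close>
lemma zonal_moment_equator_eq:
  assumes "norm t = 1" "norm t' = 1" "t \<bullet> n = 0" "t' \<bullet> n = 0"
  shows "(\<integral>\<zeta>. F \<bar>\<zeta> \<bullet> n\<bar> * G \<bar>\<zeta> \<bullet> t\<bar> \<partial>sphere_measure) = (\<integral>\<zeta>. F \<bar>\<zeta> \<bullet> n\<bar> * G \<bar>\<zeta> \<bullet> t'\<bar> \<partial>sphere_measure)"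
proof -
  let ?R = "swap_reflection t t'" and ?B = "max \<bar>F 0\<bar> \<bar>F 1\<bar> * max \<bar>G 0\<bar> \<bar>G 1\<bar>"
  have R: "?R \<zeta> \<bullet> n = \<zeta> \<bullet> n" "?R \<zeta> \<bullet> t = \<zeta> \<bullet> t'" for \<zeta>
    using assms by (simp_all add: inner_swap_reflection_adjoint swap_reflection_swaps swap_reflection_fixes)
  have "\<bar>F \<bar>\<zeta> \<bullet> n\<bar> * G \<bar>\<zeta> \<bullet> t\<bar>\<bar> \<le> ?B" if "norm \<zeta> = 1" for \<zeta>
    unfolding abs_mult using that mono_on_unit_bounded[OF F that n] mono_on_unit_bounded[OF G that assms(1)]
    by (intro mult_mono) (auto simp: le_max_iff_disj)
  then show ?thesis
    using sphere_integral_orthogonal_involution[where R = ?R and f = "\<lambda>\<zeta>. F \<bar>\<zeta> \<bullet> n\<bar> * G \<bar>\<zeta> \<bullet> t\<bar>" and B = ?B]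
    by (simp add: R linear_swap_reflection norm_swap_reflection swap_reflection_involution)
qed

text \<open>
  By the preceding lemma the equatorial direction may be chosen in the plane of \<open>n\<close> and \<open>l\<close>; call it
  \<open>t'\<close>. With \<open>R\<close> the reflection exchanging \<open>l\<close> and \<open>t'\<close>, a computation in that plane gives
  \<open>\<langle>\<zeta>, n\<rangle>\<^sup>2 - \<langle>R \<zeta>, n\<rangle>\<^sup>2 = \<langle>\<zeta>, l\<rangle>\<^sup>2 - \<langle>\<zeta>, t'\<rangle>\<^sup>2\<close>, so both factors of the
  integrand are ordered in the same way by \<open>R\<close>.
\<close>
lemma zonal_moment_ge_equator:
  assumes l: "norm l = 1" and t: "norm t = 1" "t \<bullet> n = 0"
  shows "(\<integral>\<zeta>. F \<bar>\<zeta> \<bullet> n\<bar> * G \<bar>\<zeta> \<bullet> t\<bar> \<partial>sphere_measure) \<le> (\<integral>\<zeta>. F \<bar>\<zeta> \<bullet> n\<bar> * G \<bar>\<zeta> \<bullet> l\<bar> \<partial>sphere_measure)"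
proof -
  define a where "a = l \<bullet> n"
  define r where "r = l - a *\<^sub>R n"
  define s where "s = norm r"
  \<comment> \<open>The normalized component of \<open>l\<close> orthogonal to \<open>n\<close>. If \<open>l\<close> is parallel to \<open>n\<close> this component
    vanishes, and any equatorial direction will do.\<close>
  define t' where "t' = (if r = 0 then t else r /\<^sub>R s)"
  have nn: "n \<bullet> n = 1" using n by (simp add: dot_square_norm)
  have t': "norm t' = 1" "t' \<bullet> n = 0"
    using t nn by (auto simp: t'_def s_def r_def a_def inner_diff_left)
  have l_eq: "l = a *\<^sub>R n + s *\<^sub>R t'" by (auto simp: t'_def s_def) (auto simp: r_def)
  have tt: "t' \<bullet> t' = 1" using t'(1) by (simp add: dot_square_norm)
  have "1 = l \<bullet> l" using l by (simp add: dot_square_norm)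
  also have "l \<bullet> l = a\<^sup>2 + s\<^sup>2"
    unfolding l_eq using nn tt t'(2) by (simp add: inner_add_left inner_add_right inner_commute power2_eq_square)
  finally have as: "a\<^sup>2 + s\<^sup>2 = 1" by simp
  let ?R = "swap_reflection l t'"
  have R: "\<bar>?R \<zeta> \<bullet> l\<bar> = \<bar>\<zeta> \<bullet> t'\<bar>" for \<zeta>
    by (simp add: inner_swap_reflection_adjoint swap_reflection_swaps l t')
  have sq: "(\<zeta> \<bullet> n)\<^sup>2 - (?R \<zeta> \<bullet> n)\<^sup>2 = (\<zeta> \<bullet> l)\<^sup>2 - (\<zeta> \<bullet> t')\<^sup>2" for \<zeta>
  proof (cases "s = 1")
    case True
    then have "l = t'" using as l_eq by simp
    then show ?thesis by (simp add: swap_reflection_def)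
  next
    case False
    have gap: "(norm (l - t'))\<^sup>2 = 2 * (1 - s)"
    proof -
      have "l \<bullet> t' = s" unfolding l_eq inner_add_left using tt t'(2) by (simp add: inner_commute)
      then show ?thesis
        using tt \<open>1 = l \<bullet> l\<close> by (simp add: power2_norm_eq_inner inner_diff_left inner_diff_right inner_commute)
    qed
    have lt_n: "(l - t') \<bullet> n = a" using t'(2) by (simp add: inner_diff_left a_def)
    have lz: "\<zeta> \<bullet> l = a * (\<zeta> \<bullet> n) + s * (\<zeta> \<bullet> t')" by (subst l_eq) (simp add: inner_add_right)
    have lt_z: "(l - t') \<bullet> \<zeta> = a * (\<zeta> \<bullet> n) + (s - 1) * (\<zeta> \<bullet> t')"
      unfolding inner_commute[of _ \<zeta>] inner_diff_right lz by (simp add: left_diff_distrib)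
    have "?R \<zeta> \<bullet> n = \<zeta> \<bullet> n - (a\<^sup>2 * (\<zeta> \<bullet> n) + a * (s - 1) * (\<zeta> \<bullet> t')) / (1 - s)"
      unfolding inner_swap_reflection gap lt_n lt_z using False
      by (simp add: divide_simps) (simp add: algebra_simps power2_eq_square)
    also have "\<dots> = a * (\<zeta> \<bullet> t') - s * (\<zeta> \<bullet> n)"
    proof -
      have a2: "a\<^sup>2 = (1 - s) * (1 + s)" using as by (simp add: algebra_simps power2_eq_square)
      show ?thesis unfolding a2 using False by (simp add: divide_simps) (simp add: algebra_simps)
    qed
    finally have Rn: "?R \<zeta> \<bullet> n = a * (\<zeta> \<bullet> t') - s * (\<zeta> \<bullet> n)" .
    have s2: "s\<^sup>2 = 1 - a\<^sup>2" using as by simp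
    show ?thesis unfolding Rn lz power2_diff power2_sum power_mult_distrib s2 by (simp add: algebra_simps)
  qed
  have iff: "\<bar>\<zeta> \<bullet> n\<bar> \<le> \<bar>?R \<zeta> \<bullet> n\<bar> \<longleftrightarrow> \<bar>\<zeta> \<bullet> l\<bar> \<le> \<bar>\<zeta> \<bullet> t'\<bar>"
    "\<bar>?R \<zeta> \<bullet> n\<bar> \<le> \<bar>\<zeta> \<bullet> n\<bar> \<longleftrightarrow> \<bar>\<zeta> \<bullet> t'\<bar> \<le> \<bar>\<zeta> \<bullet> l\<bar>" for \<zeta>
    using sq[of \<zeta>] unfolding abs_le_square_iff by linarith+
  have "0 \<le> (F \<bar>\<zeta> \<bullet> n\<bar> - F \<bar>?R \<zeta> \<bullet> n\<bar>) * (G \<bar>\<zeta> \<bullet> l\<bar> - G \<bar>?R \<zeta> \<bullet> l\<bar>)" if "norm \<zeta> = 1" for \<zeta>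
    unfolding R by (intro mono_on_similarly_ordered[OF F G] abs_inner_unit iff that n l t')
      (simp add: norm_swap_reflection that)
  then have "(\<integral>\<zeta>. F \<bar>\<zeta> \<bullet> n\<bar> * G \<bar>?R \<zeta> \<bullet> l\<bar> \<partial>sphere_measure) \<le> (\<integral>\<zeta>. F \<bar>\<zeta> \<bullet> n\<bar> * G \<bar>\<zeta> \<bullet> l\<bar> \<partial>sphere_measure)"
    by (intro sphere_integral_involution_rearrangement[where R = ?R
        and f = "\<lambda>\<zeta>. F \<bar>\<zeta> \<bullet> n\<bar>" and g = "\<lambda>\<zeta>. G \<bar>\<zeta> \<bullet> l\<bar>",
        OF _ _ mono_on_unit_bounded[OF F _ n] mono_on_unit_bounded[OF G _ l]
          linear_swap_reflection norm_swap_reflection swap_reflection_involution]) measurable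
  then show ?thesis
    unfolding R using zonal_moment_equator_eq[OF t(1) t'(1) t(2) t'(2)] by simp
qed

end

lemma symmetric_powr_sum_DERIV:
  fixes A B :: real
  assumes "0 \<le> B" "B < A" "0 \<le> s" "s \<le> 1"
  shows "((\<lambda>s. (A + B * s) powr k + (A - B * s) powr k) has_real_derivative
      k * B * ((A + B * s) powr (k - 1) - (A - B * s) powr (k - 1))) (at s)"
proof -
  have "B * s \<le> B" using assms by (simp add: mult_left_le)
  then have "0 < A + B * s" "0 < A - B * s" using assms by (auto intro: add_pos_nonneg)
  then show ?thesis
    by (auto intro!: derivative_eq_intros simp: algebra_simps)
qed

text \<open>
  For \<open>k \<ge> 1\<close> this even function of \<open>s\<close> is convex, and for \<open>k = 0\<close> it is constant.
\<close>
lemma mono_on_symmetric_powr_sum: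
  fixes A B :: real
  assumes "0 \<le> B" "B < A" "k = 0 \<or> 1 \<le> k"
  shows "mono_on {0..1} (\<lambda>s. (A + B * s) powr k + (A - B * s) powr k)"
proof (rule mono_onI)
  fix r t :: real assume rt: "r \<in> {0..1}" "t \<in> {0..1}" "r \<le> t"
  show "(A + B * r) powr k + (A - B * r) powr k \<le> (A + B * t) powr k + (A - B * t) powr k"
  proof (rule DERIV_nonneg_imp_nondecreasing[OF rt(3)])
    fix s assume s: "r \<le> s" "s \<le> t"
    then have s: "0 \<le> s" "s \<le> 1" using rt by auto
    have Bs: "B * s \<le> B" "0 \<le> B * s" using assms s by (simp_all add: mult_left_le)
    have "0 \<le> k * B * ((A + B * s) powr (k - 1) - (A - B * s) powr (k - 1))"
      using assms(3)
    proof
      assume "1 \<le> k"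
      then show ?thesis
        using assms(1,2) Bs
        by (intro mult_nonneg_nonneg) (auto intro!: powr_mono2)
    qed simp
    then show "\<exists>y. ((\<lambda>s. (A + B * s) powr k + (A - B * s) powr k) has_real_derivative y) (at s) \<and> 0 \<le> y"
      using symmetric_powr_sum_DERIV[OF assms(1,2) s] by blast
  qed
qed

text \<open>
  The sum itself decreases, being an even concave function; its negative is taken so that the results
  on monotone weights apply.
\<close>
lemma antimono_on_symmetric_powr_sum:
  fixes A B :: real
  assumes "0 \<le> B" "B < A" "0 \<le> k" "k \<le> 1"
  shows "mono_on {0..1} (\<lambda>s. - ((A + B * s) powr k + (A - B * s) powr k))"
proof (rule mono_onI)
  fix r t :: real assume rt: "r \<in> {0..1}" "t \<in> {0..1}" "r \<le> t"
  have "(A + B * t) powr k + (A - B * t) powr k \<le> (A + B * r) powr k + (A - B * r) powr k"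
  proof (rule DERIV_nonpos_imp_nonincreasing[OF rt(3)])
    fix s assume s: "r \<le> s" "s \<le> t"
    then have s: "0 \<le> s" "s \<le> 1" using rt by auto
    have "B * s \<le> B" "0 \<le> B * s" using assms s by (simp_all add: mult_left_le)
    then have "(A + B * s) powr (k - 1) \<le> (A - B * s) powr (k - 1)"
      using assms by (intro powr_mono2') auto
    then have "k * B * ((A + B * s) powr (k - 1) - (A - B * s) powr (k - 1)) \<le> 0"
      using assms by (intro mult_nonneg_nonpos) auto
    then show "\<exists>y. ((\<lambda>s. (A + B * s) powr k + (A - B * s) powr k) has_real_derivative y) (at s) \<and> y \<le> 0"
      using symmetric_powr_sum_DERIV[OF assms(1,2) s] by blast
  qed
  then show "- ((A + B * r) powr k + (A - B * r) powr k) \<le> - ((A + B * t) powr k + (A - B * t) powr k)"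
    by simp
qed

section \<open>Duality of Lebesgue spaces\<close>

text \<open>
  The value 1 at infinity is set separately since \<open>real_of_ereal \<infinity> = 0\<close>.
\<close>
definition conj_exponent :: "ereal \<Rightarrow> real" where
  "conj_exponent p = (if p = \<infinity> then 1 else real_of_ereal p / (real_of_ereal p - 1))"

lemma conj_exponent_ge_1: "1 < p \<Longrightarrow> 1 \<le> conj_exponent p"
  by (cases p) (auto simp: conj_exponent_def divide_simps)

context prob_space
begin

lemma integrable_bounded_powr:
  fixes g :: "'a \<Rightarrow> real"
  assumes [measurable]: "g \<in> borel_measurable M" and g: "\<And>x. x \<in> space M \<Longrightarrow> \<bar>g x\<bar> \<le> B" and "0 \<le> q"
  shows "integrable M (\<lambda>x. \<bar>g x\<bar> powr q)"
  by (rule integrable_const_bound[where B = "B powr q"]) (use g \<open>0 \<le> q\<close> in \<open>auto intro!: AE_I2 powr_mono2\<close>)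

text \<open>
  The essential supremum of an absolute value is nonnegative because the measure is not zero, and finite
  by assumption, so passing to the real numbers loses nothing.
\<close>
lemma AE_abs_le_Lp_norm_infinity:
  assumes "\<phi> \<in> Lp_space \<infinity> M"
  shows "AE x in M. \<bar>\<phi> x\<bar> \<le> Lp_norm \<infinity> M \<phi>"
proof -
  let ?e = "esssup M (\<lambda>x. ereal \<bar>\<phi> x\<bar>)"
  have AE: "AE x in M. ereal \<bar>\<phi> x\<bar> \<le> ?e" by (rule esssup_AE)
  have "\<exists>x. ereal \<bar>\<phi> x\<bar> \<le> ?e"
  proof (rule ccontr)
    assume "\<nexists>x. ereal \<bar>\<phi> x\<bar> \<le> ?e"
    then have "AE x in M. False" using AE by auto
    then show False by simp
  qed
  then have "0 \<le> ?e" by (metis abs_ge_zero ereal_less_eq(5) order_trans)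
  moreover have "?e < \<infinity>" using assms by (simp add: Lp_space_def)
  ultimately obtain e where "?e = ereal e" by (cases ?e) auto
  then show ?thesis using AE by (simp add: Lp_norm_def)
qed

lemma Lp_space_integrable:
  assumes "1 < p" and \<phi>: "\<phi> \<in> Lp_space p M"
  shows "integrable M \<phi>"
proof (cases p)
  case (real r)
  then have r: "1 < r" and [measurable]: "\<phi> \<in> borel_measurable M"
    and int: "integrable M (\<lambda>x. \<bar>\<phi> x\<bar> powr r)"
    using assms by (auto simp: Lp_space_def)
  have "\<bar>\<phi> x\<bar> \<le> 1 + \<bar>\<phi> x\<bar> powr r" for x
  proof (cases "\<bar>\<phi> x\<bar> \<le> 1")
    case False
    then have "\<bar>\<phi> x\<bar> powr 1 \<le> \<bar>\<phi> x\<bar> powr r" using r by (intro powr_mono) auto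
    then show ?thesis using False by simp
  qed (simp add: add_increasing2)
  then have "AE x in M. norm (\<phi> x) \<le> norm (1 + \<bar>\<phi> x\<bar> powr r)"
    by (intro AE_I2) (metis abs_ge_self order_trans real_norm_def)
  moreover have "integrable M (\<lambda>x. 1 + \<bar>\<phi> x\<bar> powr r)" using int by simp
  ultimately show ?thesis by (intro Bochner_Integration.integrable_bound[of M _ \<phi>]) measurable
next
  case PInf
  then show ?thesis
    using AE_abs_le_Lp_norm_infinity[of \<phi>] \<phi>
    by (intro integrable_const_bound[where B = "Lp_norm \<infinity> M \<phi>"]) (auto simp: Lp_space_def)
qed (use assms in auto)

text \<open>
  Young's inequality for the functions normalized to norm 1, integrated.
\<close>
lemma Holder_inequality_powr:
  fixes f g :: "'a \<Rightarrow> real"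
  assumes r: "1 < r" "1 < q" "1 / r + 1 / q = 1"
    and [measurable]: "f \<in> borel_measurable M" "g \<in> borel_measurable M"
    and f: "integrable M (\<lambda>x. \<bar>f x\<bar> powr r)" and g: "integrable M (\<lambda>x. \<bar>g x\<bar> powr q)"
  shows "\<bar>\<integral>x. g x * f x \<partial>M\<bar> \<le> (\<integral>x. \<bar>g x\<bar> powr q \<partial>M) powr (1 / q) * (\<integral>x. \<bar>f x\<bar> powr r \<partial>M) powr (1 / r)"
proof -
  define F where "F = (\<integral>x. \<bar>f x\<bar> powr r \<partial>M)"
  define G where "G = (\<integral>x. \<bar>g x\<bar> powr q \<partial>M)"
  have "0 \<le> F" "0 \<le> G" by (simp_all add: F_def G_def)
  show ?thesis
  proof (cases "F = 0 \<or> G = 0")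
    case True
    then have "AE x in M. g x * f x = 0"
      unfolding F_def G_def using integral_nonneg_eq_0_iff_AE[OF f] integral_nonneg_eq_0_iff_AE[OF g]
      by auto
    then have "(\<integral>x. g x * f x \<partial>M) = 0" by (rule integral_eq_zero_AE)
    then show ?thesis by simp
  next
    case False
    then have F: "0 < F" and G: "0 < G" using \<open>0 \<le> F\<close> \<open>0 \<le> G\<close> by auto
    define a where "a = F powr (1 / r)"
    define b where "b = G powr (1 / q)"
    have a: "0 < a" "a powr r = F" and b: "0 < b" "b powr q = G"
      using F G r by (simp_all add: a_def b_def powr_powr)
    have young: "\<bar>g x * f x\<bar> \<le> (b * a) * ((\<bar>f x\<bar> powr r / F) / r + (\<bar>g x\<bar> powr q / G) / q)" for x
    proof -
      have "(\<bar>f x\<bar> / a) * (\<bar>g x\<bar> / b) \<le> (\<bar>f x\<bar> / a) powr r / r + (\<bar>g x\<bar> / b) powr q / q"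
        using r a(1) b(1) by (intro Youngs_inequality) auto
      then show ?thesis
        using a b by (simp add: powr_divide abs_mult field_simps)
    qed
    have int: "integrable M (\<lambda>x. (b * a) * ((\<bar>f x\<bar> powr r / F) / r + (\<bar>g x\<bar> powr q / G) / q))"
      using f g by simp
    have "\<bar>\<integral>x. g x * f x \<partial>M\<bar> \<le> (\<integral>x. \<bar>g x * f x\<bar> \<partial>M)" by (rule integral_abs_bound)
    also have "\<dots> \<le> (\<integral>x. (b * a) * ((\<bar>f x\<bar> powr r / F) / r + (\<bar>g x\<bar> powr q / G) / q) \<partial>M)"
    proof (intro integral_mono int young Bochner_Integration.integrable_bound[OF int] AE_I2)
      show "norm \<bar>g x * f x\<bar> \<le> norm ((b * a) * ((\<bar>f x\<bar> powr r / F) / r + (\<bar>g x\<bar> powr q / G) / q))" for x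
        unfolding real_norm_def abs_abs by (rule order_trans[OF young abs_ge_self])
    qed measurable
    also have "\<dots> = (b * a) * ((F / F) / r + (G / G) / q)"
      using f g by (simp add: F_def[symmetric] G_def[symmetric])
    also have "\<dots> = b * a" using F G r by simp
    finally show ?thesis by (simp add: a_def b_def F_def G_def)
  qed
qed

lemma Lp_dual_upper:
  assumes p: "1 < p" and [measurable]: "g \<in> borel_measurable M"
    and g: "\<And>x. x \<in> space M \<Longrightarrow> \<bar>g x\<bar> \<le> B" and \<phi>: "\<phi> \<in> Lp_space p M"
  shows "\<bar>\<integral>x. g x * \<phi> x \<partial>M\<bar> \<le>
    (\<integral>x. \<bar>g x\<bar> powr conj_exponent p \<partial>M) powr (1 / conj_exponent p) * Lp_norm p M \<phi>"
proof (cases p)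
  case (real r)
  then have "1 < r" using p by simp
  then have r: "1 < r / (r - 1)" "1 / r + 1 / (r / (r - 1)) = 1" by (simp_all add: field_simps)
  have q: "conj_exponent p = r / (r - 1)" using real by (simp add: conj_exponent_def)
  show ?thesis
    using Holder_inequality_powr[OF \<open>1 < r\<close> r _ _ _ integrable_bounded_powr[OF assms(2) g], of \<phi>] \<phi> r(1)
    unfolding q by (simp add: real Lp_norm_def Lp_space_def)
next
  case PInf
  have [measurable]: "\<phi> \<in> borel_measurable M" using \<phi> by (simp add: Lp_space_def)
  have int: "integrable M (\<lambda>x. \<bar>g x\<bar>)"
    using integrable_bounded_powr[OF assms(2) g, of 1] by simp
  have le: "AE x in M. \<bar>g x * \<phi> x\<bar> \<le> \<bar>g x\<bar> * Lp_norm \<infinity> M \<phi>"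
    using AE_abs_le_Lp_norm_infinity[OF \<phi>[unfolded PInf]]
    by eventually_elim (simp add: abs_mult mult_left_mono)
  have "\<bar>\<integral>x. g x * \<phi> x \<partial>M\<bar> \<le> (\<integral>x. \<bar>g x * \<phi> x\<bar> \<partial>M)" by (rule integral_abs_bound)
  also have "\<dots> \<le> (\<integral>x. \<bar>g x\<bar> * Lp_norm \<infinity> M \<phi> \<partial>M)"
  proof (rule integral_mono_AE[OF _ _ le])
    show dom: "integrable M (\<lambda>x. \<bar>g x\<bar> * Lp_norm \<infinity> M \<phi>)"
      using int by (rule integrable_mult_left)
    have "AE x in M. norm \<bar>g x * \<phi> x\<bar> \<le> norm (\<bar>g x\<bar> * Lp_norm \<infinity> M \<phi>)"
      using le by eventually_elim (metis abs_abs abs_ge_self order_trans real_norm_def)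
    then show "integrable M (\<lambda>x. \<bar>g x * \<phi> x\<bar>)"
      by (intro Bochner_Integration.integrable_bound[OF dom]) measurable
  qed
  finally show ?thesis using PInf by (simp add: conj_exponent_def)
qed (use p in auto)

text \<open>
  The sign \<open>sg\<close> of \<open>g\<close>, with value 1 where \<open>g\<close> vanishes, has norm 1 for every \<open>p\<close>. It is extremal
  for \<open>p = \<infinity>\<close> and shows \<open>C \<ge> 0\<close> in general. For finite \<open>p\<close> the extremal function is
  \<open>sg |g|\<^sup>q\<^sup>-\<^sup>1\<close>.
\<close>
lemma Lp_dual_extremal:
  assumes p: "1 < p" and [measurable]: "g \<in> borel_measurable M"
    and g: "\<And>x. x \<in> space M \<Longrightarrow> \<bar>g x\<bar> \<le> B"
    and C: "\<And>\<phi>. \<phi> \<in> Lp_space p M \<Longrightarrow> \<bar>\<integral>x. g x * \<phi> x \<partial>M\<bar> \<le> C * Lp_norm p M \<phi>"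
  shows "(\<integral>x. \<bar>g x\<bar> powr conj_exponent p \<partial>M) powr (1 / conj_exponent p) \<le> C"
proof -
  define sg where "sg x = (if 0 \<le> g x then 1 else - 1 :: real)" for x
  have [measurable]: "sg \<in> borel_measurable M" unfolding sg_def by measurable
  have sg: "\<bar>sg x\<bar> = 1" "g x * sg x = \<bar>g x\<bar>" for x by (simp_all add: sg_def)
  have ess: "esssup M (\<lambda>x. 1 :: ereal) = 1" by (rule esssup_const) (simp add: emeasure_space_1)
  have "sg \<in> Lp_space p M" "Lp_norm p M sg = 1"
    by (simp_all add: Lp_space_def Lp_norm_def sg ess prob_space one_ereal_def[symmetric])
  then have C1: "(\<integral>x. \<bar>g x\<bar> \<partial>M) \<le> C" using C[of sg] by (simp add: sg)
  moreover have "0 \<le> (\<integral>x. \<bar>g x\<bar> \<partial>M)" by simp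
  ultimately have C0: "0 \<le> C" by linarith
  show ?thesis
  proof (cases p)
    case (real r)
    then have r: "1 < r" using p by simp
    define q where "q = r / (r - 1)"
    have q: "conj_exponent p = q" using real by (simp add: conj_exponent_def q_def)
    have q1: "1 < q" "(q - 1) * r = q" "1 - 1 / r = 1 / q" using r by (simp_all add: q_def field_simps)
    define \<phi> where "\<phi> x = sg x * \<bar>g x\<bar> powr (q - 1)" for x
    define I where "I = (\<integral>x. \<bar>g x\<bar> powr q \<partial>M)"
    have pow: "\<bar>\<phi> x\<bar> powr r = \<bar>g x\<bar> powr q" for x
      using q1 by (simp add: \<phi>_def abs_mult sg powr_powr)
    have [measurable]: "\<phi> \<in> borel_measurable M" unfolding \<phi>_def by measurable
    have "\<phi> \<in> Lp_space p M"
      using integrable_bounded_powr[OF assms(2) g, of q] q1 by (simp add: Lp_space_def real pow)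
    moreover have "g x * \<phi> x = \<bar>g x\<bar> powr q" for x
    proof -
      have "g x * \<phi> x = \<bar>g x\<bar> powr 1 * \<bar>g x\<bar> powr (q - 1)"
        using sg(2)[of x] by (simp add: \<phi>_def mult.assoc[symmetric])
      then show ?thesis by (simp only: powr_add[symmetric]) simp
    qed
    moreover have "Lp_norm p M \<phi> = I powr (1 / r)" by (simp add: Lp_norm_def real pow I_def)
    moreover have I0: "0 \<le> I" by (simp add: I_def)
    ultimately have le: "I \<le> C * I powr (1 / r)" using C[of \<phi>] by (simp add: I_def)
    show ?thesis
    proof (cases "I = 0")
      case False
      have "I powr (1 / q) * I powr (1 / r) = I powr (1 / q + 1 / r)" by (simp only: powr_add)
      also have "1 / q + 1 / r = 1" using q1(3) by simp
      finally have "I powr (1 / q) * I powr (1 / r) = I" using I0 by simp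
      then have "I powr (1 / q) * I powr (1 / r) \<le> C * I powr (1 / r)" using le by simp
      then show ?thesis using False I0 by (simp add: q I_def[symmetric])
    qed (use C0 in \<open>simp add: q I_def\<close>)
  qed (use C1 p in \<open>auto simp: conj_exponent_def\<close>)
qed

theorem Lp_dual_norm:
  assumes p: "1 < p" and "g \<in> borel_measurable M"
    and "\<And>x. x \<in> space M \<Longrightarrow> \<bar>g x\<bar> \<le> B"
  shows "(LEAST C. \<forall>\<phi> \<in> Lp_space p M. \<bar>\<integral>x. g x * \<phi> x \<partial>M\<bar> \<le> C * Lp_norm p M \<phi>) =
    (\<integral>x. \<bar>g x\<bar> powr conj_exponent p \<partial>M) powr (1 / conj_exponent p)"
  by (rule Least_equality) (use Lp_dual_upper[OF assms] Lp_dual_extremal[OF assms] in auto)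

end

section \<open>The gradient of the hyperbolic Poisson integral\<close>

text \<open>
  Differentiation under the integral sign. The bound on the gradients makes \<open>k\<close> Lipschitz in its first
  argument by the mean value theorem, so the difference quotients are dominated by a multiple of
  \<open>\<bar>\<phi>\<bar>\<close>, and dominated convergence applies along sequences tending to \<open>x\<close>.
\<close>
lemma GDERIV_integral:
  fixes k :: "'a::euclidean_space \<Rightarrow> 'b \<Rightarrow> real" and G :: "'a \<Rightarrow> 'b \<Rightarrow> 'a"
  assumes \<phi>: "integrable M \<phi>" and r: "0 < r"
    and meas [measurable]: "\<And>y. k y \<in> borel_measurable M" "G x \<in> borel_measurable M"
    and deriv: "\<And>y \<zeta>. y \<in> ball x r \<Longrightarrow> \<zeta> \<in> space M \<Longrightarrow> GDERIV (\<lambda>y. k y \<zeta>) y :> G y \<zeta>"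
    and G: "\<And>y \<zeta>. y \<in> ball x r \<Longrightarrow> \<zeta> \<in> space M \<Longrightarrow> norm (G y \<zeta>) \<le> B"
    and k: "\<And>\<zeta>. \<zeta> \<in> space M \<Longrightarrow> \<bar>k x \<zeta>\<bar> \<le> B0"
  shows "GDERIV (\<lambda>y. \<integral>\<zeta>. k y \<zeta> * \<phi> \<zeta> \<partial>M) x :> (\<integral>\<zeta>. \<phi> \<zeta> *\<^sub>R G x \<zeta> \<partial>M)"
proof -
  have [measurable]: "\<phi> \<in> borel_measurable M" using \<phi> by simp
  have xr: "x \<in> ball x r" using r by simp
  have lip: "\<bar>k y \<zeta> - k x \<zeta>\<bar> \<le> B * norm (y - x)" if "y \<in> ball x r" "\<zeta> \<in> space M" for y \<zeta>
  proof -
    have "norm (k y \<zeta> - k x \<zeta>) \<le> B * norm (y - x)"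
    proof (rule differentiable_bound[OF convex_ball])
      fix z assume z: "z \<in> ball x r"
      show "((\<lambda>y. k y \<zeta>) has_derivative (\<lambda>h. h \<bullet> G z \<zeta>)) (at z within ball x r)"
        using deriv[OF z that(2)] by (simp add: gderiv_def has_derivative_at_withinI)
      show "onorm (\<lambda>h. h \<bullet> G z \<zeta>) \<le> B"
      proof (rule onorm_le)
        fix h
        have "norm (h \<bullet> G z \<zeta>) \<le> norm h * norm (G z \<zeta>)" using Cauchy_Schwarz_ineq2[of h] by simp
        also have "\<dots> \<le> norm h * B" using G[OF z that(2)] by (rule mult_left_mono) simp
        finally show "norm (h \<bullet> G z \<zeta>) \<le> B * norm h" by (simp add: mult.commute)
      qed
    qed (use that xr in auto)
    then show ?thesis by simp
  qed
  have dom: "integrable M f" if [measurable]: "f \<in> borel_measurable M"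
    and "\<And>\<zeta>. \<zeta> \<in> space M \<Longrightarrow> norm (f \<zeta>) \<le> C * \<bar>\<phi> \<zeta>\<bar>"
    for f :: "'b \<Rightarrow> 'c :: {banach, second_countable_topology}" and C
  proof (rule Bochner_Integration.integrable_bound)
    show "integrable M (\<lambda>\<zeta>. C * \<bar>\<phi> \<zeta>\<bar>)" using \<phi> by simp
    show "AE \<zeta> in M. norm (f \<zeta>) \<le> norm (C * \<bar>\<phi> \<zeta>\<bar>)"
      using that(2) by (intro AE_I2) (metis abs_ge_self order_trans real_norm_def)
  qed measurable
  have int_k: "integrable M (\<lambda>\<zeta>. k y \<zeta> * \<phi> \<zeta>)" if y: "y \<in> ball x r" for y
  proof (rule dom)
    fix \<zeta> assume "\<zeta> \<in> space M"
    then have "\<bar>k y \<zeta>\<bar> \<le> B0 + B * norm (y - x)" using lip[OF y] k by fastforce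
    then show "norm (k y \<zeta> * \<phi> \<zeta>) \<le> (B0 + B * norm (y - x)) * \<bar>\<phi> \<zeta>\<bar>"
      by (simp add: abs_mult mult_right_mono)
  qed measurable
  have int_G: "integrable M (\<lambda>\<zeta>. \<phi> \<zeta> *\<^sub>R G x \<zeta>)"
  proof (rule dom)
    fix \<zeta> assume "\<zeta> \<in> space M"
    then show "norm (\<phi> \<zeta> *\<^sub>R G x \<zeta>) \<le> B * \<bar>\<phi> \<zeta>\<bar>"
      using mult_right_mono[OF G[OF xr], of \<zeta> "\<bar>\<phi> \<zeta>\<bar>"] by (simp add: mult.commute)
  qed measurable
  let ?u = "\<lambda>y. \<integral>\<zeta>. k y \<zeta> * \<phi> \<zeta> \<partial>M" and ?D = "\<integral>\<zeta>. \<phi> \<zeta> *\<^sub>R G x \<zeta> \<partial>M"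
  \<comment> \<open>The error of the linear approximation, relative to the size of the increment.\<close>
  define Q where "Q y \<zeta> = (k y \<zeta> - k x \<zeta> - (y - x) \<bullet> G x \<zeta>) / norm (y - x)" for y \<zeta>
  have [measurable]: "Q y \<in> borel_measurable M" for y unfolding Q_def by measurable
  have Q: "\<bar>Q y \<zeta>\<bar> \<le> 2 * B" if "y \<in> ball x r" "y \<noteq> x" "\<zeta> \<in> space M" for y \<zeta>
  proof -
    have "\<bar>(y - x) \<bullet> G x \<zeta>\<bar> \<le> norm (y - x) * norm (G x \<zeta>)" by (rule Cauchy_Schwarz_ineq2)
    also have "\<dots> \<le> norm (y - x) * B" using G[OF xr that(3)] by (rule mult_left_mono) simp
    finally have "\<bar>k y \<zeta> - k x \<zeta> - (y - x) \<bullet> G x \<zeta>\<bar> \<le> 2 * B * norm (y - x)"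
      using lip[OF that(1,3)] unfolding mult.assoc mult.commute[of "norm (y - x)"] by linarith
    then show ?thesis using that(2) by (simp add: Q_def divide_simps)
  qed
  have quot: "norm (?u y - ?u x - (y - x) \<bullet> ?D) / norm (y - x) = \<bar>\<integral>\<zeta>. Q y \<zeta> * \<phi> \<zeta> \<partial>M\<bar>"
    if y: "y \<in> ball x r" for y
  proof -
    have inner: "(y - x) \<bullet> ?D = (\<integral>\<zeta>. (y - x) \<bullet> (\<phi> \<zeta> *\<^sub>R G x \<zeta>) \<partial>M)"
      by (rule integral_inner_right[symmetric]) (rule int_G)
    have "(\<integral>\<zeta>. Q y \<zeta> * \<phi> \<zeta> \<partial>M)
        = (\<integral>\<zeta>. (k y \<zeta> * \<phi> \<zeta> - k x \<zeta> * \<phi> \<zeta> - (y - x) \<bullet> (\<phi> \<zeta> *\<^sub>R G x \<zeta>)) / norm (y - x) \<partial>M)"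
      by (intro Bochner_Integration.integral_cong refl) (simp add: Q_def algebra_simps)
    also have "\<dots> = (?u y - ?u x - (y - x) \<bullet> ?D) / norm (y - x)"
      unfolding inner using int_k[OF y] int_k[OF xr] integrable_inner_right[OF int_G, of "y - x"] by simp
    finally show ?thesis by simp
  qed
  have lim: "((\<lambda>y. norm (?u y - ?u x - (y - x) \<bullet> ?D) / norm (y - x)) \<longlongrightarrow> 0) (at x)"
    unfolding tendsto_at_iff_sequentially
  proof (intro allI impI)
    fix X :: "nat \<Rightarrow> 'a" assume X: "\<forall>i. X i \<in> UNIV - {x}" "X \<longlonglongrightarrow> x"
    obtain m where m: "\<And>i. m \<le> i \<Longrightarrow> X i \<in> ball x r"
      using X(2) r unfolding lim_sequentially by (metis dist_commute mem_ball)
    let ?Y = "\<lambda>i. X (i + m)"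
    have Y: "?Y i \<in> ball x r" "?Y i \<noteq> x" for i using m X(1) by auto
    have "(\<lambda>i. \<integral>\<zeta>. Q (?Y i) \<zeta> * \<phi> \<zeta> \<partial>M) \<longlonglongrightarrow> (\<integral>\<zeta>. 0 \<partial>M)"
    proof (rule integral_dominated_convergence[where w = "\<lambda>\<zeta>. 2 * B * \<bar>\<phi> \<zeta>\<bar>"])
      show "AE \<zeta> in M. (\<lambda>i. Q (?Y i) \<zeta> * \<phi> \<zeta>) \<longlonglongrightarrow> 0"
      proof (intro AE_I2)
        fix \<zeta> assume \<zeta>: "\<zeta> \<in> space M"
        have "((\<lambda>y. norm (k y \<zeta> - k x \<zeta> - (y - x) \<bullet> G x \<zeta>) / norm (y - x)) \<longlongrightarrow> 0) (at x)"
          using deriv[OF xr \<zeta>] unfolding gderiv_def has_derivative_iff_norm by blast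
        then have "((\<lambda>y. \<bar>Q y \<zeta>\<bar>) \<longlongrightarrow> 0) (at x)"
          by (simp add: Q_def abs_divide)
        then have "((\<lambda>y. Q y \<zeta>) \<longlongrightarrow> 0) (at x)" by (rule tendsto_rabs_zero_cancel)
        then have "(\<lambda>i. Q (X i) \<zeta>) \<longlonglongrightarrow> 0"
          using X unfolding tendsto_at_iff_sequentially by (auto simp: o_def)
        then have "(\<lambda>i. Q (?Y i) \<zeta>) \<longlonglongrightarrow> 0" by (rule LIMSEQ_ignore_initial_segment)
        then show "(\<lambda>i. Q (?Y i) \<zeta> * \<phi> \<zeta>) \<longlonglongrightarrow> 0" by (rule tendsto_mult_left_zero)
      qed
      show "AE \<zeta> in M. norm (Q (?Y i) \<zeta> * \<phi> \<zeta>) \<le> 2 * B * \<bar>\<phi> \<zeta>\<bar>" for i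
        using Q[OF Y] by (intro AE_I2) (simp add: abs_mult mult_right_mono)
    qed (use \<phi> in auto)
    then have "(\<lambda>i. \<bar>\<integral>\<zeta>. Q (?Y i) \<zeta> * \<phi> \<zeta> \<partial>M\<bar>) \<longlonglongrightarrow> 0"
      by (intro tendsto_rabs_zero) simp
    then have "(\<lambda>i. norm (?u (?Y i) - ?u x - (?Y i - x) \<bullet> ?D) / norm (?Y i - x)) \<longlonglongrightarrow> 0"
      by (simp only: quot[OF Y(1)])
    then show "((\<lambda>y. norm (?u y - ?u x - (y - x) \<bullet> ?D) / norm (y - x)) \<circ> X) \<longlonglongrightarrow> 0"
      unfolding o_def by (rule LIMSEQ_offset)
  qed
  show ?thesis
    unfolding gderiv_def has_derivative_iff_norm
    using lim by (simp add: bounded_linear_inner_left)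
qed

lemma gradient_eqI:
  assumes "GDERIV u x :> D"
  shows "gradient u x = D"
  unfolding gradient_def
proof (rule the_equality)
  show "GDERIV u x :> D" by fact
next
  fix D' assume "GDERIV u x :> D'"
  then have "(\<lambda>h. h \<bullet> D') = (\<lambda>h. h \<bullet> D)"
    using assms unfolding gderiv_def by (rule has_derivative_unique)
  then show "D' = D" by (metis vector_eq_ldot)
qed

text \<open>
  This is where the chord map enters: up to the factor, the logarithmic gradient
  \<open>- 2 x / (1 - |x|\<^sup>2) - 2 (x - \<zeta>) / |x - \<zeta>|\<^sup>2\<close> is the chord map, hence of norm independent of
  \<open>\<zeta>\<close>.
\<close>
lemma GDERIV_chord_ratio:
  assumes "norm x < 1" "norm \<zeta> = 1"
  shows "GDERIV (\<lambda>x. chord_ratio x \<zeta>) x :> - (2 * chord_ratio x \<zeta> / (1 - (norm x)\<^sup>2)) *\<^sub>R chord_map x \<zeta>"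
proof -
  define w where "w = x - \<zeta>"
  have w: "w \<bullet> w \<noteq> 0" using assms by (auto simp: w_def)
  have N: "1 - x \<bullet> x \<noteq> 0" using one_minus_norm_pos[OF assms(1)] by (simp add: power2_norm_eq_inner)
  have ratio: "chord_ratio x \<zeta> = (1 - x \<bullet> x) / (w \<bullet> w)"
    by (simp add: chord_ratio_def w_def power2_norm_eq_inner)
  have map: "chord_map x \<zeta> = x + chord_ratio x \<zeta> *\<^sub>R w"
    using chord_map_sphere[OF assms(2), of x] by (simp add: w_def algebra_simps)
  have "((\<lambda>x. (1 - x \<bullet> x) / ((x - \<zeta>) \<bullet> (x - \<zeta>))) has_derivative
      (\<lambda>h. (- 2 * (h \<bullet> x) * (w \<bullet> w) - (1 - x \<bullet> x) * (2 * (h \<bullet> w))) / ((w \<bullet> w) * (w \<bullet> w)))) (at x)"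
    using w unfolding w_def
    by (intro has_derivative_divide'[THEN has_derivative_eq_rhs] derivative_eq_intros refl)
       (auto simp: inner_commute)
  moreover have "(- 2 * (h \<bullet> x) * (w \<bullet> w) - (1 - x \<bullet> x) * (2 * (h \<bullet> w))) / ((w \<bullet> w) * (w \<bullet> w))
      = h \<bullet> (- (2 * chord_ratio x \<zeta> / (1 - (norm x)\<^sup>2)) *\<^sub>R chord_map x \<zeta>)" for h
    unfolding power2_norm_eq_inner map inner_scaleR_right inner_add_right ratio using w N
    by (simp add: divide_simps) (simp add: algebra_simps)
  ultimately show ?thesis
    unfolding gderiv_def by (simp add: chord_ratio_def[abs_def] power2_norm_eq_inner)
qed

lemma hyp_poisson_kernel_eq: "hyp_poisson_kernel x \<zeta> = chord_ratio x \<zeta> ^ (CARD('n) - 1)"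
  for x :: "real ^ 'n"
  by (simp add: hyp_poisson_kernel_def chord_ratio_def)

lemma GDERIV_hyp_poisson_kernel:
  fixes x :: "real ^ 'n"
  assumes "norm x < 1" "norm \<zeta> = 1"
  shows "GDERIV (\<lambda>x. hyp_poisson_kernel x \<zeta>) x :>
    - (2 * real (CARD('n) - 1) / (1 - (norm x)\<^sup>2) * hyp_poisson_kernel x \<zeta>) *\<^sub>R chord_map x \<zeta>"
proof -
  define N where "N = CARD('n) - 1"
  define c where "c = chord_ratio x \<zeta>"
  have "GDERIV (\<lambda>x. chord_ratio x \<zeta> ^ N) x :>
      (real N * c ^ (N - Suc 0)) *\<^sub>R - (2 * c / (1 - (norm x)\<^sup>2)) *\<^sub>R chord_map x \<zeta>"
    unfolding c_def by (rule GDERIV_DERIV_compose[OF GDERIV_chord_ratio[OF assms] DERIV_pow])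
  moreover have "(real N * c ^ (N - Suc 0)) * - (2 * c / (1 - (norm x)\<^sup>2))
      = - (2 * real N / (1 - (norm x)\<^sup>2) * c ^ N)"
    by (cases N) simp_all
  ultimately show ?thesis
    unfolding hyp_poisson_kernel_eq N_def[symmetric] c_def[symmetric] by (simp only: scaleR_scaleR)
qed

lemma chord_ratio_le:
  assumes "norm \<zeta> = 1" "0 < r" "norm y \<le> 1 - r"
  shows "0 \<le> chord_ratio y \<zeta>" "chord_ratio y \<zeta> \<le> 1 / r\<^sup>2"
proof -
  have "r \<le> norm (y - \<zeta>)" using norm_triangle_ineq2[of \<zeta> y] assms by (simp add: norm_minus_commute)
  then have r: "r\<^sup>2 \<le> (norm (y - \<zeta>))\<^sup>2" using assms(2) by (intro power_mono) auto
  have "(norm y)\<^sup>2 \<le> 1" using assms(2,3) by (simp add: power_le_one)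
  then show "0 \<le> chord_ratio y \<zeta>" by (simp add: chord_ratio_def)
  show "chord_ratio y \<zeta> \<le> 1 / r\<^sup>2"
    unfolding chord_ratio_def using r assms(2) \<open>(norm y)\<^sup>2 \<le> 1\<close> by (intro frac_le) auto
qed

lemma hyp_poisson_kernel_bounds:
  fixes y :: "real ^ 'n"
  assumes "norm \<zeta> = 1" "0 < r" "norm y \<le> 1 - r"
  shows "0 \<le> hyp_poisson_kernel y \<zeta>" "hyp_poisson_kernel y \<zeta> \<le> (1 / r\<^sup>2) ^ (CARD('n) - 1)"
  unfolding hyp_poisson_kernel_eq using chord_ratio_le[OF assms] by (auto intro: power_mono)

lemma measurable_hyp_poisson_kernel [measurable]:
  "hyp_poisson_kernel x \<in> borel_measurable borel"
  unfolding hyp_poisson_kernel_def[abs_def] by measurable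

text \<open>
  In a ball around \<open>x\<close> with radius half the distance to the sphere, the kernel and its gradient are
  bounded uniformly in \<open>\<zeta>\<close>.
\<close>
lemma GDERIV_hyp_poisson:
  fixes x :: "real ^ 'n"
  assumes \<phi>: "integrable sphere_measure \<phi>" and x: "norm x < 1"
  shows "GDERIV (hyp_poisson \<phi>) x :> (\<integral>\<zeta>. \<phi> \<zeta> *\<^sub>R
    (- (2 * real (CARD('n) - 1) / (1 - (norm x)\<^sup>2) * hyp_poisson_kernel x \<zeta>) *\<^sub>R chord_map x \<zeta>) \<partial>sphere_measure)"
proof -
  \<comment> \<open>Every \<open>y\<close> in the ball of radius \<open>r\<close> around \<open>x\<close> has distance at least \<open>r\<close> from the sphere.\<close>
  define r where "r = (1 - norm x) / 2"
  have r: "0 < r" using x by (simp add: r_def)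
  have ball: "norm y \<le> 1 - r" if "y \<in> ball x r" for y
    using that norm_triangle_ineq2[of y x] by (simp add: dist_norm norm_minus_commute r_def field_simps)
  have lt: "norm y < 1" if "y \<in> ball x r" for y using ball[OF that] r by simp
  show ?thesis
    unfolding hyp_poisson_def[abs_def]
  proof (rule GDERIV_integral[OF \<phi> r])
    show "hyp_poisson_kernel y \<in> borel_measurable sphere_measure" for y :: "real ^ 'n"
      by (intro borel_measurable_sphere_measure) measurable
    show "(\<lambda>\<zeta>. - (2 * real (CARD('n) - 1) / (1 - (norm x)\<^sup>2) * hyp_poisson_kernel x \<zeta>) *\<^sub>R chord_map x \<zeta>)
        \<in> borel_measurable sphere_measure"
      by (intro borel_measurable_sphere_measure) measurable
  next
    fix \<zeta> :: "real ^ 'n" assume "\<zeta> \<in> space sphere_measure"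
    then have \<zeta>: "norm \<zeta> = 1" by (simp add: space_sphere_measure)
    show "\<bar>hyp_poisson_kernel x \<zeta>\<bar> \<le> (1 / r\<^sup>2) ^ (CARD('n) - 1)"
      using hyp_poisson_kernel_bounds[OF \<zeta> r ball, of x] r by simp
    fix y assume y: "y \<in> ball x r"
    show "GDERIV (\<lambda>y. hyp_poisson_kernel y \<zeta>) y :>
        - (2 * real (CARD('n) - 1) / (1 - (norm y)\<^sup>2) * hyp_poisson_kernel y \<zeta>) *\<^sub>R chord_map y \<zeta>"
      by (rule GDERIV_hyp_poisson_kernel[OF lt[OF y] \<zeta>])
    have "(norm y)\<^sup>2 \<le> norm y" using lt[OF y] by (simp add: power2_eq_square mult_left_le)
    then have "r \<le> 1 - (norm y)\<^sup>2" using ball[OF y] by simp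
    then have "2 * real (CARD('n) - 1) / (1 - (norm y)\<^sup>2) * hyp_poisson_kernel y \<zeta>
        \<le> 2 * real (CARD('n) - 1) / r * (1 / r\<^sup>2) ^ (CARD('n) - 1)"
      using r hyp_poisson_kernel_bounds[OF \<zeta> r ball[OF y]] by (intro mult_mono divide_left_mono) auto
    moreover have "0 \<le> 2 * real (CARD('n) - 1) / (1 - (norm y)\<^sup>2) * hyp_poisson_kernel y \<zeta>"
      using \<open>r \<le> 1 - (norm y)\<^sup>2\<close> r hyp_poisson_kernel_bounds[OF \<zeta> r ball[OF y]] by simp
    ultimately show "norm (- (2 * real (CARD('n) - 1) / (1 - (norm y)\<^sup>2) * hyp_poisson_kernel y \<zeta>) *\<^sub>R chord_map y \<zeta>)
        \<le> 2 * real (CARD('n) - 1) / r * (1 / r\<^sup>2) ^ (CARD('n) - 1)"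
      unfolding norm_scaleR abs_minus_cancel norm_chord_map[OF lt[OF y]] \<zeta> by (simp only: abs_of_nonneg mult_1_right)
  qed
qed

lemma inner_gradient_hyp_poisson:
  fixes x :: "real ^ 'n"
  assumes \<phi>: "integrable sphere_measure \<phi>" and x: "norm x < 1"
  shows "gradient (hyp_poisson \<phi>) x \<bullet> l = (\<integral>\<zeta>. - (2 * real (CARD('n) - 1) / (1 - (norm x)\<^sup>2) *
      hyp_poisson_kernel x \<zeta> * (chord_map x \<zeta> \<bullet> l)) * \<phi> \<zeta> \<partial>sphere_measure)"
proof -
  let ?c = "2 * real (CARD('n) - 1) / (1 - (norm x)\<^sup>2)"
  have c: "0 \<le> ?c" using one_minus_norm_pos[OF x] by simp
  have [measurable]: "\<phi> \<in> borel_measurable sphere_measure" using \<phi> by simp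
  have G: "(\<lambda>\<zeta>. - (?c * hyp_poisson_kernel x \<zeta>) *\<^sub>R chord_map x \<zeta>) \<in> borel_measurable sphere_measure"
    by (intro borel_measurable_sphere_measure) measurable
  have "integrable sphere_measure (\<lambda>\<zeta>. \<phi> \<zeta> *\<^sub>R (- (?c * hyp_poisson_kernel x \<zeta>) *\<^sub>R chord_map x \<zeta>))"
  proof (rule Bochner_Integration.integrable_bound)
    let ?B = "?c * (1 / (1 - norm x)\<^sup>2) ^ (CARD('n) - 1)"
    show "integrable sphere_measure (\<lambda>\<zeta>. ?B * \<phi> \<zeta>)" using \<phi> by simp
    show "AE \<zeta> in sphere_measure. norm (\<phi> \<zeta> *\<^sub>R (- (?c * hyp_poisson_kernel x \<zeta>) *\<^sub>R chord_map x \<zeta>)) \<le> norm (?B * \<phi> \<zeta>)"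
    proof (intro AE_I2)
      fix \<zeta> :: "real ^ 'n" assume "\<zeta> \<in> space sphere_measure"
      then have \<zeta>: "norm \<zeta> = 1" by (simp add: space_sphere_measure)
      note K = hyp_poisson_kernel_bounds[OF \<zeta>, of "1 - norm x" x]
      have "norm (\<phi> \<zeta> *\<^sub>R (- (?c * hyp_poisson_kernel x \<zeta>) *\<^sub>R chord_map x \<zeta>))
          = (?c * hyp_poisson_kernel x \<zeta>) * \<bar>\<phi> \<zeta>\<bar>"
      proof -
        have "0 \<le> ?c * hyp_poisson_kernel x \<zeta>" using K(1) x by (intro mult_nonneg_nonneg[OF c]) auto
        then show ?thesis
          unfolding norm_scaleR abs_minus_cancel norm_chord_map[OF x] \<zeta>
          by (simp only: abs_of_nonneg mult_1_right mult.commute)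
      qed
      also have "\<dots> \<le> ?B * \<bar>\<phi> \<zeta>\<bar>"
        using K x c by (intro mult_right_mono mult_left_mono) auto
      also have "\<dots> \<le> norm (?B * \<phi> \<zeta>)"
        unfolding real_norm_def abs_mult[of ?B] by (rule mult_right_mono[OF abs_ge_self]) simp
      finally show "norm (\<phi> \<zeta> *\<^sub>R (- (?c * hyp_poisson_kernel x \<zeta>) *\<^sub>R chord_map x \<zeta>)) \<le> norm (?B * \<phi> \<zeta>)" .
    qed
  qed (intro borel_measurable_scaleR G, measurable)
  note int = this
  show ?thesis
    unfolding gradient_eqI[OF GDERIV_hyp_poisson[OF assms]] integral_inner_left[OF int, symmetric]
    by (intro Bochner_Integration.integral_cong refl) simp
qed

section \<open>The optimal constants\<close>

text \<open>
  The directional derivative is a functional on \<open>L\<^sup>p\<close> with a bounded density, so its norm is the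
  \<open>L\<^sup>q\<close> norm of that density.
\<close>
lemma opt_const_eq:
  fixes x :: "real ^ 'n"
  assumes p: "1 < p" and x: "norm x < 1"
  shows "opt_const p x l = (\<integral>\<zeta>. \<bar>2 * real (CARD('n) - 1) / (1 - (norm x)\<^sup>2) * hyp_poisson_kernel x \<zeta> *
      (chord_map x \<zeta> \<bullet> l)\<bar> powr conj_exponent p \<partial>sphere_measure) powr (1 / conj_exponent p)"
proof -
  interpret prob_space "sphere_measure :: (real ^ 'n) measure" by (rule prob_space_sphere_measure)
  let ?g = "\<lambda>\<zeta>. - (2 * real (CARD('n) - 1) / (1 - (norm x)\<^sup>2) * hyp_poisson_kernel x \<zeta> * (chord_map x \<zeta> \<bullet> l))"
  let ?B = "2 * real (CARD('n) - 1) / (1 - (norm x)\<^sup>2) * (1 / (1 - norm x)\<^sup>2) ^ (CARD('n) - 1) * norm l"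
  have meas: "?g \<in> borel_measurable sphere_measure"
    by (intro borel_measurable_sphere_measure) measurable
  have bound: "\<bar>?g \<zeta>\<bar> \<le> ?B" if "\<zeta> \<in> space sphere_measure" for \<zeta>
  proof -
    have \<zeta>: "norm \<zeta> = 1" using that by (simp add: space_sphere_measure)
    have "\<bar>chord_map x \<zeta> \<bullet> l\<bar> \<le> norm l"
      using Cauchy_Schwarz_ineq2[of "chord_map x \<zeta>" l] by (simp add: norm_chord_map[OF x] \<zeta>)
    then show ?thesis
      using hyp_poisson_kernel_bounds[OF \<zeta>, of "1 - norm x" x] x one_minus_norm_pos[OF x]
      unfolding abs_minus_cancel abs_mult by (intro mult_mono) auto
  qed
  show ?thesis
    unfolding opt_const_def using Lp_dual_norm[OF p meas bound]
    by (simp add: inner_gradient_hyp_poisson[OF Lp_space_integrable[OF p] x] cong: ball_cong)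
qed

text \<open>
  The sum of \<open>|x - \<zeta>|\<^sup>2\<^sup>k\<close> and \<open>|x + \<zeta>|\<^sup>2\<^sup>k\<close> for a unit vector \<open>\<zeta>\<close> whose component along \<open>x\<close>
  is \<open>s\<close>.
\<close>
definition axial_weight :: "real \<Rightarrow> real ^ 'n \<Rightarrow> real \<Rightarrow> real" where
  "axial_weight k x s = (1 + (norm x)\<^sup>2 + 2 * norm x * s) powr k + (1 + (norm x)\<^sup>2 - 2 * norm x * s) powr k"

text \<open>
  The integrand is the Jacobian of the chord map times a function of the image point: in the \<open>q\<close>-th
  power of the kernel one factor is the Jacobian, and the remaining exponent \<open>q - 1\<close> yields \<open>k\<close>.
\<close>
lemma integral_kernel_powr:
  fixes x :: "real ^ 'n"
  assumes x: "norm x < 1" and q: "1 \<le> q"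
  defines "k \<equiv> real (CARD('n) - 1) * (q - 1)"
  shows "(\<integral>\<zeta>. \<bar>c * hyp_poisson_kernel x \<zeta> * (chord_map x \<zeta> \<bullet> l)\<bar> powr q \<partial>sphere_measure)
    = \<bar>c\<bar> powr q * (1 / (1 - (norm x)\<^sup>2)) powr k *
      (\<integral>\<zeta>. ((norm (x - \<zeta>))\<^sup>2) powr k * \<bar>\<zeta> \<bullet> l\<bar> powr q \<partial>sphere_measure)"
proof -
  define N where "N = CARD('n) - 1"
  let ?C = "\<bar>c\<bar> powr q * (1 / (1 - (norm x)\<^sup>2)) powr k"
  let ?h = "\<lambda>\<zeta>. ((norm (x - \<zeta>))\<^sup>2) powr k * \<bar>\<zeta> \<bullet> l\<bar> powr q"
  let ?f = "\<lambda>\<zeta>. ?C * ?h \<zeta>"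
  note pos = one_minus_norm_pos[OF x]
  have k: "0 \<le> k" using q by (simp add: k_def)
  have bound: "\<bar>?f \<zeta>\<bar> \<le> ?C * (4 powr k * norm l powr q)" if \<zeta>: "norm \<zeta> = 1" for \<zeta>
  proof -
    have "norm (x - \<zeta>) \<le> 2" using norm_triangle_ineq4[of x \<zeta>] \<zeta> x by simp
    then have "(norm (x - \<zeta>))\<^sup>2 \<le> 2\<^sup>2" by (intro power_mono) auto
    moreover have "\<bar>\<zeta> \<bullet> l\<bar> \<le> norm l" using Cauchy_Schwarz_ineq2[of \<zeta> l] \<zeta> by simp
    ultimately have "?h \<zeta> \<le> 4 powr k * norm l powr q"
      using k q by (intro mult_mono powr_mono2) auto
    then show ?thesis using mult_left_mono[of "?h \<zeta>" _ ?C] by (simp add: abs_mult)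
  qed
  have "\<bar>c * hyp_poisson_kernel x \<zeta> * (chord_map x \<zeta> \<bullet> l)\<bar> powr q = chord_ratio x \<zeta> ^ N * ?f (chord_map x \<zeta>)"
    if \<zeta>: "norm \<zeta> = 1" for \<zeta>
  proof -
    let ?r = "chord_ratio x \<zeta>"
    have r: "0 < ?r" by (rule chord_ratio_pos[OF x \<zeta>])
    have pow: "?r ^ N = ?r powr real N" using r by (simp add: powr_realpow)
    have "(?r ^ N) powr q = ?r powr (real N + k)"
      unfolding pow powr_powr k_def N_def[symmetric] by (simp add: algebra_simps)
    also have "\<dots> = ?r ^ N * ?r powr k" by (simp only: powr_add pow)
    also have "?r powr k = (1 / (1 - (norm x)\<^sup>2)) powr k * ((norm (x - chord_map x \<zeta>))\<^sup>2) powr k"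
    proof -
      have "?r = 1 / (1 - (norm x)\<^sup>2) * (norm (x - chord_map x \<zeta>))\<^sup>2"
        unfolding norm_diff_chord_map[OF x \<zeta>] using pos by simp
      then have "?r powr k = (1 / (1 - (norm x)\<^sup>2) * (norm (x - chord_map x \<zeta>))\<^sup>2) powr k"
        by (rule arg_cong)
      also have "\<dots> = (1 / (1 - (norm x)\<^sup>2)) powr k * ((norm (x - chord_map x \<zeta>))\<^sup>2) powr k"
        by (rule powr_mult)
      finally show ?thesis .
    qed
    finally have eq: "(?r ^ N) powr q
        = ?r ^ N * ((1 / (1 - (norm x)\<^sup>2)) powr k * ((norm (x - chord_map x \<zeta>))\<^sup>2) powr k)" .
    show ?thesis
      unfolding hyp_poisson_kernel_eq abs_mult N_def[symmetric] powr_mult abs_of_pos[OF zero_less_power[OF r]] eq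
      by simp
  qed
  then have "(\<integral>\<zeta>. \<bar>c * hyp_poisson_kernel x \<zeta> * (chord_map x \<zeta> \<bullet> l)\<bar> powr q \<partial>sphere_measure)
      = (\<integral>\<zeta>. chord_ratio x \<zeta> ^ N * ?f (chord_map x \<zeta>) \<partial>sphere_measure)"
    by (intro Bochner_Integration.integral_cong refl) (simp add: space_sphere_measure)
  also have "\<dots> = (\<integral>\<zeta>. ?f \<zeta> \<partial>sphere_measure)"
    unfolding N_def by (rule sphere_integral_chord_map[OF x _ bound]) measurable
  finally show ?thesis by simp
qed

text \<open>
  Averaging over \<open>\<zeta>\<close> and \<open>- \<zeta>\<close> leaves the even factor \<open>|\<langle>\<zeta>, l\<rangle>|\<^sup>q\<close> alone.
\<close>
lemma integral_symmetrize:
  fixes x :: "real ^ 'n"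
  assumes x: "x \<noteq> 0" "norm x < 1" and k: "0 \<le> k" and q: "0 \<le> q"
  shows "(\<integral>\<zeta>. ((norm (x - \<zeta>))\<^sup>2) powr k * \<bar>\<zeta> \<bullet> l\<bar> powr q \<partial>sphere_measure)
    = (1 / 2) * (\<integral>\<zeta>. axial_weight k x \<bar>\<zeta> \<bullet> (x /\<^sub>R norm x)\<bar> * \<bar>\<zeta> \<bullet> l\<bar> powr q \<partial>sphere_measure)"
proof -
  let ?h = "\<lambda>\<zeta>. ((norm (x - \<zeta>))\<^sup>2) powr k * \<bar>\<zeta> \<bullet> l\<bar> powr q"
  have bound: "\<bar>?h \<zeta>\<bar> \<le> 4 powr k * norm l powr q" if \<zeta>: "norm \<zeta> = 1" for \<zeta>
  proof -
    have "norm (x - \<zeta>) \<le> 2" using norm_triangle_ineq4[of x \<zeta>] \<zeta> x by simp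
    then have "(norm (x - \<zeta>))\<^sup>2 \<le> 2\<^sup>2" by (intro power_mono) auto
    moreover have "\<bar>\<zeta> \<bullet> l\<bar> \<le> norm l" using Cauchy_Schwarz_ineq2[of \<zeta> l] \<zeta> by simp
    ultimately have "?h \<zeta> \<le> 4 powr k * norm l powr q"
      using k q by (intro mult_mono powr_mono2) auto
    then show ?thesis by simp
  qed
  have bound': "\<bar>?h (- \<zeta>)\<bar> \<le> 4 powr k * norm l powr q" if "norm \<zeta> = 1" for \<zeta>
    using bound[of "- \<zeta>"] that by simp
  have int: "integrable sphere_measure ?h" "integrable sphere_measure (\<lambda>\<zeta>. ?h (- \<zeta>))"
    using bound bound'
    by (auto intro!: integrable_sphere_measure_bounded[where B = "4 powr k * norm l powr q"])
  have neg: "(\<integral>\<zeta>. ?h (- \<zeta>) \<partial>sphere_measure) = (\<integral>\<zeta>. ?h \<zeta> \<partial>sphere_measure)"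
    by (rule sphere_integral_orthogonal_involution[where R = uminus, OF _ bound])
       (auto intro: linearI)
  have "?h \<zeta> + ?h (- \<zeta>) = axial_weight k x \<bar>\<zeta> \<bullet> (x /\<^sub>R norm x)\<bar> * \<bar>\<zeta> \<bullet> l\<bar> powr q"
    if \<zeta>: "norm \<zeta> = 1" for \<zeta>
  proof -
    define s where "s = \<zeta> \<bullet> (x /\<^sub>R norm x)"
    have "x \<bullet> \<zeta> = norm x * s" using x by (simp add: s_def inner_commute)
    moreover have "\<zeta> \<bullet> \<zeta> = 1" using \<zeta> by (simp add: dot_square_norm)
    ultimately have "(norm (x - \<zeta>))\<^sup>2 = 1 + (norm x)\<^sup>2 - 2 * norm x * s"
      "(norm (x + \<zeta>))\<^sup>2 = 1 + (norm x)\<^sup>2 + 2 * norm x * s"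
      by (simp_all add: power2_norm_eq_inner inner_diff_left inner_diff_right inner_add_left inner_add_right inner_commute)
    then show ?thesis
      unfolding axial_weight_def s_def[symmetric] diff_minus_eq_add inner_minus_left abs_minus_cancel
      by (cases "0 \<le> s") (simp_all add: distrib_right)
  qed
  then have "(\<integral>\<zeta>. axial_weight k x \<bar>\<zeta> \<bullet> (x /\<^sub>R norm x)\<bar> * \<bar>\<zeta> \<bullet> l\<bar> powr q \<partial>sphere_measure)
      = (\<integral>\<zeta>. ?h \<zeta> + ?h (- \<zeta>) \<partial>sphere_measure)"
    by (intro Bochner_Integration.integral_cong refl) (simp add: space_sphere_measure)
  then show ?thesis using int neg by simp
qed

lemma opt_const_zonal_moment:
  fixes x :: "real ^ 'n"
  assumes p: "1 < p" and x: "x \<noteq> 0" "norm x < 1"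
  defines "q \<equiv> conj_exponent p"
  defines "k \<equiv> real (CARD('n) - 1) * (q - 1)"
  obtains K where "0 \<le> K" and "\<And>l. opt_const p x l =
    (K * (\<integral>\<zeta>. axial_weight k x \<bar>\<zeta> \<bullet> (x /\<^sub>R norm x)\<bar> * \<bar>\<zeta> \<bullet> l\<bar> powr q \<partial>sphere_measure)) powr (1 / q)"
proof
  have q: "1 \<le> q" using conj_exponent_ge_1[OF p] by (simp add: q_def)
  then have k: "0 \<le> k" by (simp add: k_def)
  let ?c = "2 * real (CARD('n) - 1) / (1 - (norm x)\<^sup>2)"
  let ?K = "\<bar>?c\<bar> powr q * (1 / (1 - (norm x)\<^sup>2)) powr k * (1 / 2)"
  show "0 \<le> ?K" by simp
  show "opt_const p x l = (?K *
      (\<integral>\<zeta>. axial_weight k x \<bar>\<zeta> \<bullet> (x /\<^sub>R norm x)\<bar> * \<bar>\<zeta> \<bullet> l\<bar> powr q \<partial>sphere_measure)) powr (1 / q)" for l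
    unfolding opt_const_eq[OF p x(2)] q_def[symmetric]
      integral_kernel_powr[OF x(2) q, folded k_def] integral_symmetrize[OF x k order_trans[OF zero_le_one q]]
    by (simp only: mult.assoc)
qed

lemma measurable_axial_weight [measurable]: "axial_weight k x \<in> borel_measurable borel"
  unfolding axial_weight_def[abs_def] by measurable

lemma axial_weight_range:
  assumes "norm x < 1"
  shows "0 \<le> 2 * norm x" "2 * norm x < 1 + (norm x)\<^sup>2"
proof -
  have "0 < (1 - norm x)\<^sup>2" using assms by simp
  then show "2 * norm x < 1 + (norm x)\<^sup>2" by (simp add: power2_diff)
qed simp

text \<open>
  For \<open>k = 0\<close> and \<open>k = 1\<close> both parts apply, which makes the constant independent of the direction.
\<close>
theorem opt_const_between:
  fixes x t l :: "real ^ 'n"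
  assumes p: "1 < p" and x: "x \<noteq> 0" "norm x < 1"
    and t: "norm t = 1" "t \<bullet> x = 0" and l: "norm l = 1"
  defines "k \<equiv> real (CARD('n) - 1) * (conj_exponent p - 1)"
  shows "k = 0 \<or> 1 \<le> k \<Longrightarrow> opt_const p x t \<le> opt_const p x l \<and> opt_const p x l \<le> opt_const p x (x /\<^sub>R norm x)"
    and "k \<le> 1 \<Longrightarrow> opt_const p x (x /\<^sub>R norm x) \<le> opt_const p x l \<and> opt_const p x l \<le> opt_const p x t"
proof -
  let ?n = "x /\<^sub>R norm x"
  define q where "q = conj_exponent p"
  define G where "G s = s powr q" for s :: real
  define F where "F = axial_weight k x"
  have q: "1 \<le> q" using conj_exponent_ge_1[OF p] by (simp add: q_def)
  then have k: "0 \<le> k" by (simp add: k_def q_def)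
  obtain K where K: "0 \<le> K" and opt: "\<And>l. opt_const p x l =
      (K * (\<integral>\<zeta>. F \<bar>\<zeta> \<bullet> ?n\<bar> * G \<bar>\<zeta> \<bullet> l\<bar> \<partial>sphere_measure)) powr (1 / q)"
    using opt_const_zonal_moment[OF p x] unfolding F_def G_def q_def k_def by blast
  have n: "norm ?n = 1" using x by simp
  have tn: "t \<bullet> ?n = 0" using t(2) by simp
  have [measurable]: "F \<in> borel_measurable borel" "G \<in> borel_measurable borel"
    unfolding F_def G_def by measurable
  have F0: "0 \<le> F s" for s by (simp add: F_def axial_weight_def)
  have G0: "0 \<le> G s" for s by (simp add: G_def)
  have G: "mono_on {0..1} G"
    using q by (auto simp: G_def intro!: mono_onI powr_mono2)
  have opt_le: "opt_const p x a \<le> opt_const p x b"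
    if "(\<integral>\<zeta>. F \<bar>\<zeta> \<bullet> ?n\<bar> * G \<bar>\<zeta> \<bullet> a\<bar> \<partial>sphere_measure) \<le> (\<integral>\<zeta>. F \<bar>\<zeta> \<bullet> ?n\<bar> * G \<bar>\<zeta> \<bullet> b\<bar> \<partial>sphere_measure)" for a b
    unfolding opt using that K q F0 G0
    by (intro powr_mono2 mult_left_mono mult_nonneg_nonneg integral_nonneg_AE AE_I2) auto
  show "opt_const p x t \<le> opt_const p x l \<and> opt_const p x l \<le> opt_const p x ?n" if "k = 0 \<or> 1 \<le> k"
  proof -
    have F: "mono_on {0..1} F"
      using mono_on_symmetric_powr_sum[OF axial_weight_range[OF x(2)] that]
      by (simp add: F_def axial_weight_def[abs_def])
    show ?thesis
      by (intro conjI opt_le zonal_moment_ge_equator[OF F G _ _ n l t(1) tn] zonal_moment_le_pole[OF F G _ _ n l])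
        measurable
  qed
  show "opt_const p x ?n \<le> opt_const p x l \<and> opt_const p x l \<le> opt_const p x t" if "k \<le> 1"
  proof -
    have F: "mono_on {0..1} (\<lambda>s. - F s)"
      using antimono_on_symmetric_powr_sum[OF axial_weight_range[OF x(2)] k that]
      by (simp add: F_def axial_weight_def[abs_def])
    have meas: "(\<lambda>s. - F s) \<in> borel_measurable borel" by measurable
    show ?thesis
      using zonal_moment_ge_equator[OF F G meas _ n l t(1) tn] zonal_moment_le_pole[OF F G meas _ n l]
      by (intro conjI opt_le) simp_all
  qed
qed

theorem theorem1:
  fixes p :: ereal and x t :: "real ^ 'n"
  assumes "1 < p" and "CARD('n) \<ge> 3"
    and "x \<in> ball 0 1 - {0}"
    and "norm t = 1" and "t \<bullet> x = 0"
  shows "(p < ereal (real CARD('n)) \<longrightarrow>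
            is_max_on (opt_const p x) (sphere 0 1) (opt_const p x (x /\<^sub>R norm x)) \<and>
            is_min_on (opt_const p x) (sphere 0 1) (opt_const p x t)) \<and>
         (p > ereal (real CARD('n)) \<longrightarrow>
            is_max_on (opt_const p x) (sphere 0 1) (opt_const p x t) \<and>
            is_min_on (opt_const p x) (sphere 0 1) (opt_const p x (x /\<^sub>R norm x))) \<and>
         (p = ereal (real CARD('n)) \<or> p = \<infinity> \<longrightarrow> opt_const p x constant_on (sphere 0 1))"
proof -
  have x: "x \<noteq> 0" "norm x < 1" using assms(3) by auto
  define k where "k = real (CARD('n) - 1) * (conj_exponent p - 1)"
  note between = opt_const_between[OF assms(1) x assms(4,5), folded k_def]
  have n: "norm (x /\<^sub>R norm x) = 1" using x by simp
  have k_infinity: "k = 0" if "p = \<infinity>" using that by (simp add: k_def conj_exponent_def)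
  have k_real: "k = (real CARD('n) - 1) / (r - 1)" if "p = ereal r" for r
  proof -
    have "1 < r" using that assms(1) by simp
    then have "r / (r - 1) - 1 = 1 / (r - 1)" by (simp add: field_simps)
    then show ?thesis using that assms(2) by (simp add: k_def conj_exponent_def of_nat_diff)
  qed
  have k_ge: "1 \<le> k" if "p \<le> ereal (real CARD('n))"
    using that assms(1) k_real by (cases p) auto
  have k_le: "k \<le> 1" if "ereal (real CARD('n)) \<le> p"
    using that assms(1) k_real k_infinity by (cases p) auto
  have "opt_const p x l = opt_const p x (x /\<^sub>R norm x)" if "k \<le> 1" "k = 0 \<or> 1 \<le> k" "norm l = 1" for l
    using between[OF that(3)] that(1,2) by (intro antisym) auto
  then have const: "opt_const p x constant_on sphere 0 1" if "k \<le> 1" "k = 0 \<or> 1 \<le> k"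
    using that by (auto simp: constant_on_def)
  have max_radial: "is_max_on (opt_const p x) (sphere 0 1) (opt_const p x (x /\<^sub>R norm x)) \<and>
      is_min_on (opt_const p x) (sphere 0 1) (opt_const p x t)" if "1 \<le> k"
    using between(1) that n assms(4) by (auto simp: is_max_on_def is_min_on_def)
  have max_tangential: "is_max_on (opt_const p x) (sphere 0 1) (opt_const p x t) \<and>
      is_min_on (opt_const p x) (sphere 0 1) (opt_const p x (x /\<^sub>R norm x))" if "k \<le> 1"
    using between(2) that n assms(4) by (auto simp: is_max_on_def is_min_on_def)
  show ?thesis
    using max_radial max_tangential const k_ge k_le k_infinity by (auto simp: less_imp_le)
qed

end
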